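(* Let $c\in\mathbb C$ with $\Re(c)\leq 0$ and $c\neq 0$. Then the topological closure $\overline{\sigma_c(\mathbb N)}$ of the set $\sigma_c(\mathbb N)=\{\sigma_c(n)\colon n\in\mathbb N\}\subseteq\mathbb C$ has finitely many connected components.
   Context: For $c\in\mathbb C$, the divisor function $\sigma_c\colon\mathbb N\to\mathbb C$ is defined by $\sigma_c(n)=\sum_{d\mid n}d^c$, the sum over positive divisors $d$ of $n$, where $d^c=e^{c\log d}$ with $\log d$ real. The closure is taken in $\mathbb C$ with its usual topology. *)

theory Defs
  imports "HOL-Analysis.Analysis"
begin

definition divisor_sigma :: "complex \<Rightarrow> nat \<Rightarrow> complex" where
  "divisor_sigma c n = (\<Sum>d | d dvd n. of_nat d powr c)"

(* For n > 0 every divisor is positive, so powr is exp (c * ln d) with the real logarithm. *)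
lemma divisor_sigma_exp:
  assumes "n > 0"
  shows "divisor_sigma c n = (\<Sum>d | d dvd n. exp (c * of_real (ln (real d))))"
  unfolding divisor_sigma_def
proof (rule sum.cong)
  fix d assume "d \<in> {d. d dvd n}"
  then have "d > 0" using assms by (auto intro: Nat.gr0I)
  then show "of_nat d powr c = exp (c * of_real (ln (real d)))"
    by (simp add: powr_def Ln_of_nat)
qed simp

end

theory Submission
  imports Defs "HOL-Real_Asymp.Real_Asymp" "HOL-Computational_Algebra.Primes"
begin

text \<open>
  If \<open>c = ib\<close>, all primes but at most one have \<open>b log p / 2\<pi>\<close> irrational, and then the values at the powers
  of \<open>p\<close> are dense in a circle through 0. Choosing such a \<open>p\<close> that does not divide \<open>n\<close>, the multiple of
  this circle by \<open>\<sigma>(n)\<close> joins \<open>\<sigma>(n)\<close> to 0 inside the closure, which is therefore connected.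

  If \<open>Re c < 0\<close>, Chebyshev-type estimates yield, at every scale, boundedly many pairs of primes such
  that the numbers \<open>log (1 + p^c)\<close> shrink slowly and their directions do not concentrate on a line
  (unless \<open>c\<close> is real). A greedy choice of signs then writes every small number as a difference of two
  subsums of these logarithms. Hence the closure of the set of subsums of any tail is compact,
  connected (as in Kakeya's theorem) and meets its small translates. Multiplying the exponential of
  such a set by \<open>\<sigma>(n)\<close> joins \<open>\<sigma>(n p^k)\<close> to \<open>\<sigma>(n)\<close> when \<open>p\<close> is large and exceeds the primes of \<open>n\<close>, so
  every value is joined to one at an integer with only small prime factors. Those values are
  bounded and bounded away from 0, and two of them with ratio close to 1 are joined, which leaves
  finitely many components.
\<close>

section \<open>Subsums of slowly decreasing sequences of vectors\<close>

text \<open>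
  The terms come in pairs \<^term>\<open>v (2*n)\<close>, \<^term>\<open>v (Suc (2*n))\<close> of size about \<^term>\<open>\<theta> ^ n\<close>. Since no vector is nearly
  orthogonal to both members of a pair, adding or subtracting one of them always shortens a
  remainder that is long compared to the pair; \<open>lower\<close> says that \<open>\<theta>\<close> is so close to 1 that
  this gain keeps up with the decay of the terms. The subspace is the real line for real
  exponents, where the directions cannot spread.
\<close>

locale subsum_sequence =
  fixes v :: "nat \<Rightarrow> 'a::euclidean_space" and V :: "'a set" and \<theta> \<kappa> M :: real
  assumes V: "subspace V" and vV: "v k \<in> V"
    and \<theta>: "0 < \<theta>" "\<theta> < 1" and \<kappa>: "0 < \<kappa>" "\<kappa> \<le> 1/2" and M: "0 < M"
    and upper: "norm (v k) \<le> \<kappa> * M * \<theta> ^ Suc (k div 2)"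
    and lower: "2 * M * (1 - \<theta>) * \<theta> ^ (k div 2) \<le> \<kappa> * norm (v k)"
    and spread: "r \<in> V \<Longrightarrow> \<exists>k\<in>{2*n,Suc (2*n)}. \<kappa> * norm r * norm (v k) \<le> \<bar>r \<bullet> v k\<bar>"
begin

text \<open>The index \<open>n\<close> counts pairs, so the tail starts at \<open>2*n\<close>. The
  closure makes the set compact, which turns distance 0 between two translates into a common
  point.\<close>

definition subsums :: "nat \<Rightarrow> 'a set" where
  "subsums n = closure {sum v A | A. finite A \<and> A \<subseteq> {2*n..}}"

lemma sum_in_subsums: "finite A \<Longrightarrow> A \<subseteq> {2*n..} \<Longrightarrow> sum v A \<in> subsums n"
  unfolding subsums_def by (rule closure_subset[THEN subsetD]) auto

lemma zero_in_subsums: "0 \<in> subsums n"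
  using sum_in_subsums[of "{}"] by simp

lemma closed_subsums: "closed (subsums n)"
  by (simp add: subsums_def)

text \<open>With the sign chosen against \<open>r\<close>, the cross term removes at least
  \<open>2 * \<kappa> * norm r * norm w\<close> from the squared norm. As \<open>w\<close> is short,
  its own square gives back at most half of that, and the other half pays for the linear
  gain.\<close>

lemma norm_add_signed_le:
  assumes "\<kappa> * norm r * norm w \<le> \<bar>r \<bullet> w\<bar>" and "norm w \<le> \<kappa> * norm r"
  shows "norm (r + w) \<le> norm r - \<kappa> * norm w / 2 \<or> norm (r - w) \<le> norm r - \<kappa> * norm w / 2"
proof -
  have pos: "0 \<le> norm r - \<kappa> * norm w / 2"
  proof -
    have "\<kappa> * norm w \<le> 1 * (\<kappa> * norm r)" using assms(2) \<kappa> by (intro mult_mono) auto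
    also have "\<dots> \<le> norm r" using \<kappa> mult_right_mono[of \<kappa> 1 "norm r"] by simp
    finally show ?thesis using norm_ge_zero[of r] by linarith
  qed
  have le: "(norm r)\<^sup>2 + (norm w)\<^sup>2 - 2 * \<bar>r \<bullet> w\<bar> \<le> (norm r - \<kappa> * norm w / 2)\<^sup>2"
  proof -
    have "(norm w)\<^sup>2 \<le> \<kappa> * norm r * norm w"
      unfolding power2_eq_square using assms(2) by (intro mult_right_mono) auto
    then have "(norm r)\<^sup>2 + (norm w)\<^sup>2 - 2 * \<bar>r \<bullet> w\<bar> \<le> (norm r)\<^sup>2 - \<kappa> * norm r * norm w"
      using assms(1) by linarith
    also have "\<dots> \<le> (norm r - \<kappa> * norm w / 2)\<^sup>2"
      by (simp add: power2_eq_square algebra_simps mult_nonneg_nonneg less_imp_le \<kappa>(1))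
    finally show ?thesis .
  qed
  show ?thesis
  proof (cases "r \<bullet> w \<ge> 0")
    case True
    have "(norm (r - w))\<^sup>2 = (norm r)\<^sup>2 + (norm w)\<^sup>2 - 2 * \<bar>r \<bullet> w\<bar>"
      using True by (simp add: power2_norm_eq_inner inner_diff_left inner_diff_right inner_commute)
    then have "(norm (r - w))\<^sup>2 \<le> (norm r - \<kappa> * norm w / 2)\<^sup>2" using le by simp
    then show ?thesis using pos by (auto intro: power2_le_imp_le)
  next
    case False
    have "(norm (r + w))\<^sup>2 = (norm r)\<^sup>2 + (norm w)\<^sup>2 - 2 * \<bar>r \<bullet> w\<bar>"
      using False by (simp add: power2_norm_eq_inner inner_add_left inner_add_right inner_commute)
    then have "(norm (r + w))\<^sup>2 \<le> (norm r - \<kappa> * norm w / 2)\<^sup>2" using le by simp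
    then show ?thesis using pos by (auto intro: power2_le_imp_le)
  qed
qed

text \<open>A remainder already below the next bound is left alone. Otherwise \<open>upper\<close>
  makes the well-aligned vector short compared to it, and by \<open>lower\<close> the gain
  \<open>\<kappa> * norm (v k) / 2\<close> covers the drop from \<open>M * \<theta> ^ n\<close> to
  \<open>M * \<theta> ^ Suc n\<close>. Added vectors go to \<open>A\<close>, subtracted ones to
  \<open>B\<close>.\<close>

lemma greedy_step:
  assumes "r \<in> V" and "norm r \<le> M * \<theta> ^ n"
  obtains A B where "A \<subseteq> {2*n,Suc (2*n)}" "B \<subseteq> {2*n,Suc (2*n)}"
    "norm (r + sum v A - sum v B) \<le> M * \<theta> ^ Suc n"
proof (cases "norm r \<le> M * \<theta> ^ Suc n")
  case True
  then show ?thesis using that[of "{}" "{}"] by simp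
next
  case False
  obtain k where k: "k \<in> {2*n,Suc (2*n)}" "\<kappa> * norm r * norm (v k) \<le> \<bar>r \<bullet> v k\<bar>"
    using spread[OF assms(1)] by blast
  have kn: "k div 2 = n" using k(1) by auto
  have "norm (v k) \<le> \<kappa> * (M * \<theta> ^ Suc n)" using upper[of k] kn by (simp add: mult.assoc)
  also have "\<dots> \<le> \<kappa> * norm r" using False \<kappa> by (intro mult_left_mono) auto
  finally have "norm (v k) \<le> \<kappa> * norm r" .
  from norm_add_signed_le[OF k(2) this] 
  have "norm (r + v k) \<le> norm r - \<kappa> * norm (v k) / 2 \<or> norm (r - v k) \<le> norm r - \<kappa> * norm (v k) / 2" .
  moreover have "norm r - \<kappa> * norm (v k) / 2 \<le> M * \<theta> ^ Suc n"
    using lower[of k] assms(2) kn by (simp add: algebra_simps)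
  ultimately consider "norm (r + v k) \<le> M * \<theta> ^ Suc n" | "norm (r - v k) \<le> M * \<theta> ^ Suc n"
    by linarith
  then show ?thesis
  proof cases
    case 1 then show ?thesis using that[of "{k}" "{}"] k(1) by auto
  next
    case 2 then show ?thesis using that[of "{}" "{k}"] k(1) by auto
  qed
qed

text \<open>As \<open>j\<close> grows, \<open>sum v B - sum v A\<close> approximates
  \<open>r\<close> with both index sets inside the tail. Successive pairs are disjoint, so the
  choices of the single steps can be united.\<close>

lemma greedy:
  assumes "r \<in> V" and "norm r \<le> M * \<theta> ^ n"
  shows "\<exists>A B. A \<subseteq> {2*n..<2*(n+j)} \<and> B \<subseteq> {2*n..<2*(n+j)} \<and>
    norm (r + sum v A - sum v B) \<le> M * \<theta> ^ (n+j)"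
proof (induction j)
  case 0
  show ?case using assms by (intro exI[of _ "{}"]) auto
next
  case (Suc j)
  then obtain A B where AB: "A \<subseteq> {2*n..<2*(n+j)}" "B \<subseteq> {2*n..<2*(n+j)}"
    and le: "norm (r + sum v A - sum v B) \<le> M * \<theta> ^ (n+j)" by blast
  have fin: "finite A" "finite B" using AB finite_subset by blast+
  have "r + sum v A - sum v B \<in> V"
    using V assms(1) vV by (intro subspace_diff subspace_add subspace_sum) auto
  then obtain A' B' where AB': "A' \<subseteq> {2*(n+j),Suc (2*(n+j))}" "B' \<subseteq> {2*(n+j),Suc (2*(n+j))}"
    and le': "norm (r + sum v A - sum v B + sum v A' - sum v B') \<le> M * \<theta> ^ Suc (n+j)"
    using greedy_step le by blast
  have fin': "finite A'" "finite B'" using AB' finite_subset by blast+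
  have A: "sum v (A \<union> A') = sum v A + sum v A'"
    using AB AB' fin fin' by (intro sum.union_disjoint) fastforce+
  have B: "sum v (B \<union> B') = sum v B + sum v B'"
    using AB AB' fin fin' by (intro sum.union_disjoint) fastforce+
  show ?case
  proof (rule exI[of _ "A \<union> A'"], rule exI[of _ "B \<union> B'"], intro conjI)
    show "norm (r + sum v (A \<union> A') - sum v (B \<union> B')) \<le> M * \<theta> ^ (n + Suc j)"
      using le' unfolding A B by (simp add: algebra_simps)
  qed (use AB AB' in \<open>(force simp: subset_iff)+\<close>)
qed

text \<open>The geometric series of the bounds \<open>2 * \<kappa> * M * \<theta> ^ Suc k\<close>
  over all pairs \<open>k \<ge> n\<close>.\<close>

definition tail_bound :: "nat \<Rightarrow> real" where
  "tail_bound n = 2 * \<kappa> * M * \<theta> / (1 - \<theta>) * \<theta> ^ n"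

lemma tail_bound_tendsto_0: "tail_bound \<longlonglongrightarrow> 0"
  unfolding tail_bound_def using \<theta> by (intro tendsto_mult_right_zero LIMSEQ_power_zero) auto

lemma norm_subsum_le:
  assumes "finite A" "A \<subseteq> {2*n..}"
  shows "norm (sum v A) \<le> tail_bound n"
proof -
  \<comment> \<open>The partial geometric sum is written as a difference so that the induction
    telescopes.\<close>
  have ind: "(\<Sum>k = 2*n..<2*(n+j). norm (v k)) \<le> 2 * \<kappa> * M * \<theta> / (1 - \<theta>) * (\<theta> ^ n - \<theta> ^ (n+j))" for j
  proof (induction j)
    case (Suc j)
    have split: "{2*n..<2*(n+Suc j)} = {2*n..<2*(n+j)} \<union> {2*(n+j), Suc (2*(n+j))}" by auto
    have "(\<Sum>k = 2*n..<2*(n+Suc j). norm (v k)) =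
      (\<Sum>k = 2*n..<2*(n+j). norm (v k)) + (norm (v (2*(n+j))) + norm (v (Suc (2*(n+j)))))"
      unfolding split by (subst sum.union_disjoint) auto
    also have "\<dots> \<le> 2 * \<kappa> * M * \<theta> / (1 - \<theta>) * (\<theta> ^ n - \<theta> ^ (n+j)) + 2 * \<kappa> * M * \<theta> ^ Suc (n+j)"
      using Suc upper[of "2*(n+j)"] upper[of "Suc (2*(n+j))"] by simp
    also have "2 * \<kappa> * M * \<theta> ^ Suc (n+j) = 2 * \<kappa> * M * \<theta> / (1 - \<theta>) * (\<theta> ^ (n+j) - \<theta> ^ (n + Suc j))"
      using \<theta> by (simp add: field_simps)
    finally show ?case by (simp only: distrib_left[symmetric]) simp
  qed simp
  obtain N where N: "A \<subseteq> {..<N}" using assms(1) finite_nat_iff_bounded by blast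
  have "norm (sum v A) \<le> (\<Sum>k\<in>A. norm (v k))" by (rule norm_sum)
  also have "\<dots> \<le> (\<Sum>k = 2*n..<2*(n+N). norm (v k))"
    using assms N by (intro sum_mono2) fastforce+
  also have "\<dots> \<le> 2 * \<kappa> * M * \<theta> / (1 - \<theta>) * (\<theta> ^ n - \<theta> ^ (n+N))" by (rule ind)
  also have "\<dots> \<le> tail_bound n"
    unfolding tail_bound_def using \<theta> \<kappa> M by (intro mult_left_mono) auto
  finally show ?thesis .
qed

lemma subsums_subset_cball: "subsums n \<subseteq> cball 0 (tail_bound n)"
  unfolding subsums_def by (rule closure_minimal) (auto simp: norm_subsum_le)

lemma compact_subsums: "compact (subsums n)"
  using subsums_subset_cball[of n] closed_subsums bounded_subset[OF bounded_cball] compact_eq_bounded_closed by blast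

text \<open>By \<open>greedy\<close>, \<open>r + sum v A\<close> and \<open>sum v B\<close> come
  arbitrarily close for index sets in the tail, so the two sets have distance 0; being compact, they
  meet.\<close>

lemma translate_meets_subsums:
  assumes "r \<in> V" and "norm r \<le> M * \<theta> ^ n"
  shows "(+) r ` subsums n \<inter> subsums n \<noteq> {}"
proof -
  have "setdist ((+) r ` subsums n) (subsums n) \<le> M * \<theta> ^ (n + j)" for j
  proof -
    obtain A B where AB: "A \<subseteq> {2*n..<2*(n+j)}" "B \<subseteq> {2*n..<2*(n+j)}"
      and le: "norm (r + sum v A - sum v B) \<le> M * \<theta> ^ (n+j)" using greedy[OF assms] by blast
    have "finite A" "A \<subseteq> {2*n..}" "finite B" "B \<subseteq> {2*n..}"
      using AB finite_subset[OF AB(1)] finite_subset[OF AB(2)] by auto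
    then have "setdist ((+) r ` subsums n) (subsums n) \<le> dist (r + sum v A) (sum v B)"
      by (intro setdist_le_dist imageI sum_in_subsums)
    then show ?thesis using le by (simp add: dist_norm)
  qed
  moreover have "(\<lambda>j. M * \<theta> ^ (n + j)) \<longlonglongrightarrow> 0"
    unfolding power_add using \<theta> by (intro tendsto_mult_right_zero LIMSEQ_power_zero) auto
  ultimately have "setdist ((+) r ` subsums n) (subsums n) \<le> 0"
    by (intro LIMSEQ_le_const) auto
  then have "setdist ((+) r ` subsums n) (subsums n) = 0" using setdist_pos_le order_antisym by blast
  moreover have "compact ((+) r ` subsums n)" by (rule compact_translation[OF compact_subsums])
  moreover have "subsums n \<noteq> {}" using zero_in_subsums by auto
  ultimately show ?thesis
    using setdist_eq_0_compact_closed[of "(+) r ` subsums n" "subsums n"] closed_subsums by simp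
qed

text \<open>Finite subsums are sorted by the members of the first pair that they use. The finite
  union of closed translates is closed, so the inclusion passes to the closure.\<close>

lemma subsums_split:
  "subsums n \<subseteq> (\<Union>H\<in>Pow {2*n, Suc (2*n)}. (+) (sum v H) ` subsums (Suc n))" (is "_ \<subseteq> ?U")
proof -
  have "sum v A \<in> ?U" if A: "finite A" "A \<subseteq> {2*n..}" for A
  proof -
    define H where "H = A \<inter> {2*n, Suc (2*n)}"
    have "H \<in> Pow {2*n, Suc (2*n)}" by (simp add: H_def)
    moreover have "sum v A = sum v H + sum v (A - H)"
      using A sum.subset_diff[of H A v] by (simp add: H_def add.commute)
    moreover have "sum v (A - H) \<in> subsums (Suc n)"
    proof (rule sum_in_subsums)
      show "A - H \<subseteq> {2 * Suc n..}"
      proof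
        fix k assume "k \<in> A - H"
        then have "2*n \<le> k" "k \<noteq> 2*n" "k \<noteq> Suc (2*n)" using A unfolding H_def by auto
        then show "k \<in> {2 * Suc n..}" by simp
      qed
    qed (use A in simp)
    ultimately show ?thesis by blast
  qed
  moreover have "closed ?U"
    by (intro closed_UN ballI closed_translation closed_subsums) simp
  ultimately show ?thesis
    unfolding subsums_def[of n] by (intro closure_minimal) blast+
qed

lemma translate_subsums_subset:
  assumes "G \<subseteq> {2*n..<2*m}" and "n \<le> m"
  shows "(+) (sum v G) ` subsums m \<subseteq> subsums n"
proof -
  have "(+) (sum v G) ` subsums m = closure ((+) (sum v G) ` {sum v A | A. finite A \<and> A \<subseteq> {2*m..}})"
    unfolding subsums_def by (simp add: closure_translation)
  also have "\<dots> \<subseteq> closure {sum v A | A. finite A \<and> A \<subseteq> {2*n..}}"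
  proof (rule closure_mono, clarify)
    fix A assume A: "finite A" "A \<subseteq> {2*m..}"
    have "finite G" using assms finite_subset by blast
    then have "sum v G + sum v A = sum v (G \<union> A)"
      using A assms by (intro sum.union_disjoint[symmetric]) fastforce+
    moreover have "finite (G \<union> A)" "G \<union> A \<subseteq> {2*n..}" using A \<open>finite G\<close> assms by fastforce+
    ultimately show "\<exists>A'. sum v G + sum v A = sum v A' \<and> finite A' \<and> A' \<subseteq> {2*n..}" by blast
  qed
  finally show ?thesis by (simp add: subsums_def)
qed

text \<open>
  In a separation of the set of subsums, translates of a far tail have small diameter and so lie on
  one side. A translate of a longer tail consists of translates of the next tail that all meet one
  of them, so it lies on one side as well, down to the whole set.
\<close>

lemma connected_subsums: "connected (subsums n)"
proof (rule ccontr)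
  assume "\<not> connected (subsums n)"
  then have "\<exists>A B. closed A \<and> closed B \<and> A \<noteq> {} \<and> B \<noteq> {} \<and> A \<union> B = subsums n \<and> A \<inter> B = {}"
    by (simp only: connected_closed_set[OF closed_subsums] not_not)
  then obtain A B where AB: "closed A" "closed B" "A \<noteq> {}" "B \<noteq> {}" "A \<union> B = subsums n" "A \<inter> B = {}"
    by (elim exE conjE) (rule that)
  have "compact A" using AB compact_subsums by (metis Un_upper1 compact_Int_closed inf.absorb_iff2)
  then obtain d where d: "d > 0" "\<And>x y. x \<in> A \<Longrightarrow> y \<in> B \<Longrightarrow> d \<le> dist x y"
    using separate_compact_closed[of A B] AB by blast
  obtain N where N: "\<And>m. m \<ge> N \<Longrightarrow> tail_bound m < d / 2"
    using order_tendstoD(2)[OF tail_bound_tendsto_0, of "d/2"] d(1)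
    by (auto simp: eventually_sequentially)
  \<comment> \<open>The maximum ensures \<open>n \<le> N'\<close>, so that the downward induction
    from \<open>N'\<close> reaches \<open>n\<close>.\<close>
  define N' where "N' = max N n"
  have "\<forall>G. G \<subseteq> {2*n..<2*m} \<longrightarrow> (+) (sum v G) ` subsums m \<subseteq> A \<or> (+) (sum v G) ` subsums m \<subseteq> B"
    if "n \<le> m" "m \<le> N'" for m
    using that(2,1)
  proof (induction rule: inc_induct)
    case base
    show ?case
    proof (intro allI impI disjCI)
      fix G assume G: "G \<subseteq> {2*n..<2*N'}" and "\<not> (+) (sum v G) ` subsums N' \<subseteq> B"
      then obtain z where z: "z \<in> subsums N'" "sum v G + z \<notin> B" by blast
      have sub: "(+) (sum v G) ` subsums N' \<subseteq> A \<union> B"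
        using translate_subsums_subset[OF G] AB(5) base by simp
      show "(+) (sum v G) ` subsums N' \<subseteq> A"
      proof clarify
        fix y assume y: "y \<in> subsums N'"
        show "sum v G + y \<in> A"
        proof (rule ccontr)
          assume "sum v G + y \<notin> A"
          then have "sum v G + y \<in> B" "sum v G + z \<in> A" using sub y z by blast+
          then have "d \<le> dist (sum v G + z) (sum v G + y)" using d(2) by blast
          also have "\<dots> = dist z y" by (simp add: dist_norm)
          also have "\<dots> \<le> norm z + norm y" by (simp add: dist_norm norm_triangle_ineq4)
          also have "\<dots> < d"
            using subsetD[OF subsums_subset_cball y] subsetD[OF subsums_subset_cball z(1)] N[of N']
            by (simp add: N'_def)
          finally show False by simp
        qed
      qed
    qed
  next
    case (step m)
    have IH: "\<And>G. G \<subseteq> {2*n..<2*Suc m} \<Longrightarrow> (+) (sum v G) ` subsums (Suc m) \<subseteq> A \<or> (+) (sum v G) ` subsums (Suc m) \<subseteq> B"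
      using step.IH step.prems by auto
    show ?case
    proof (intro allI impI)
      fix G assume G: "G \<subseteq> {2*n..<2*m}"
      have fG: "finite G" using G finite_subset by blast
      let ?P = "\<lambda>H. (+) (sum v (G \<union> H)) ` subsums (Suc m)"
      have sumGH: "sum v (G \<union> H) = sum v G + sum v H" if "H \<subseteq> {2*m, Suc (2*m)}" for H
        using that G fG finite_subset[OF that] by (intro sum.union_disjoint) fastforce+
      have meet: "?P H \<inter> ?P {} \<noteq> {}" if H: "H \<subseteq> {2*m, Suc (2*m)}" for H
      proof -
        have "norm (sum v H) \<le> (\<Sum>k\<in>H. norm (v k))" by (rule norm_sum)
        also have "\<dots> \<le> (\<Sum>k\<in>{2*m, Suc (2*m)}. norm (v k))" using H by (intro sum_mono2) auto
        also have "\<dots> \<le> 2 * \<kappa> * (M * \<theta> ^ Suc m)" using upper[of "2*m"] upper[of "Suc (2*m)"] by simp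
        \<comment> \<open>By \<open>\<kappa> \<le> 1/2\<close> even a whole pair is no longer than
          the shifts under which the next tail is known to meet itself.\<close>
        also have "\<dots> \<le> 1 * (M * \<theta> ^ Suc m)" using \<kappa> \<theta> M by (intro mult_right_mono) auto
        finally have "norm (sum v H) \<le> M * \<theta> ^ Suc m" by simp
        moreover have "sum v H \<in> V" using V vV by (intro subspace_sum) auto
        ultimately obtain x y where "x \<in> subsums (Suc m)" "y \<in> subsums (Suc m)" "sum v H + x = y"
          using translate_meets_subsums by blast
        then have "sum v (G \<union> H) + x = sum v (G \<union> {}) + y" using sumGH[OF H] by simp
        then show ?thesis using \<open>x \<in> _\<close> \<open>y \<in> _\<close> by blast
      qed
      have cover: "(+) (sum v G) ` subsums m \<subseteq> (\<Union>H\<in>Pow {2*m, Suc (2*m)}. ?P H)"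
      proof clarify
        fix x assume "x \<in> subsums m"
        then obtain H y where H: "H \<subseteq> {2*m, Suc (2*m)}" "y \<in> subsums (Suc m)" "x = sum v H + y"
          using subsums_split by blast
        then have "sum v G + x = sum v (G \<union> H) + y" using sumGH[OF H(1)] by simp
        then show "sum v G + x \<in> (\<Union>H\<in>Pow {2*m, Suc (2*m)}. ?P H)" using H by blast
      qed
      have or: "?P H \<subseteq> A \<or> ?P H \<subseteq> B" if "H \<subseteq> {2*m, Suc (2*m)}" for H
        using that G step.prems by (intro IH) fastforce
      obtain C where C: "?P {} \<subseteq> C" "C = A \<or> C = B" using or[of "{}"] by auto
      have "?P H \<subseteq> C" if "H \<in> Pow {2*m, Suc (2*m)}" for H
        using or[of H] meet[of H] that C AB(6) by blast
      then have "(+) (sum v G) ` subsums m \<subseteq> C" using UN_least subset_trans[OF cover] by meson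
      then show "(+) (sum v G) ` subsums m \<subseteq> A \<or> (+) (sum v G) ` subsums m \<subseteq> B"
        using C(2) by auto
    qed
  qed
  from this[of n] have "subsums n \<subseteq> A \<or> subsums n \<subseteq> B"
    unfolding N'_def by (force dest: spec[of _ "{}"])
  then show False using AB by blast
qed

end

section \<open>Pairs of primes with spread logarithms\<close>

text \<open>The interval is half-open so that consecutive blocks of primes are disjoint.\<close>

definition primes_in :: "real \<Rightarrow> real \<Rightarrow> nat set" where
  "primes_in x y = {p. prime p \<and> x < real p \<and> real p \<le> y}"

lemma finite_primes_in [simp]: "finite (primes_in x y)"
proof (rule finite_subset)
  show "primes_in x y \<subseteq> {..nat \<lfloor>y\<rfloor>}" unfolding primes_in_def by (auto simp: le_nat_floor)
qed simp

lemma primes_in_mono: "x' \<le> x \<Longrightarrow> y \<le> y' \<Longrightarrow> primes_in x y \<subseteq> primes_in x' y'"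
  by (auto simp: primes_in_def)

lemma primes_in_split: "x \<le> y \<Longrightarrow> y \<le> z \<Longrightarrow> primes_in x z = primes_in x y \<union> primes_in y z"
  by (auto simp: primes_in_def)

text \<open>
  Leibniz's harmonic triangle: \<open>1/((k+1) C(n,k+1)) = 1/(k C(n-1,k)) - 1/(k C(n,k))\<close>; multiply by the
  least common multiple.
\<close>

lemma mult_binomial_dvd_Lcm:
  assumes "1 \<le> k" "k \<le> n"
  shows "k * (n choose k) dvd (Lcm {1..n} :: nat)"
  using assms
proof (induction k arbitrary: n rule: nat_induct_at_least)
  case base
  then show ?case by (simp add: dvd_Lcm)
next
  case (Suc k)
  then obtain m where n: "n = Suc m" and km: "k \<le> m" "1 \<le> k" by (cases n) auto
  define l where "l = (Lcm {1..n} :: nat)"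
  have "Lcm {1..m} dvd l" unfolding l_def by (rule Lcm_subset) (auto simp: n)
  then have "k * (m choose k) dvd l" using Suc.IH[of m] km dvd_trans by blast
  then obtain i where i: "l = k * (m choose k) * i" by (elim dvdE)
  have "k * (n choose k) dvd l" using Suc.IH[of n] km n unfolding l_def by simp
  then obtain j where j: "l = k * (n choose k) * j" by (elim dvdE)
  have pos: "real (n choose k) > 0" "real (m choose k) > 0" "real k > 0" using km n by auto
  have e1: "real (Suc k) * real (n choose Suc k) = (real n - real k) * real (n choose k)"
  proof -
    have "Suc k * (n choose Suc k) = (n - k) * (n choose k)"
      by (metis binomial_absorption binomial_absorb_comp)
    then show ?thesis using km n by (metis of_nat_diff of_nat_mult Suc.prems Suc_leD)
  qed
  have e2: "real n * real (m choose k) = (real n - real k) * real (n choose k)"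
  proof -
    have "(n - k) * (n choose k) = n * (m choose k)"
      using binomial_absorb_comp[of n k] n by simp
    then show ?thesis using km n by (metis of_nat_diff of_nat_mult Suc.prems Suc_leD)
  qed
  have nk: "real n - real k > 0" using km n by simp
  have li: "real l = real k * real (m choose k) * real i" using i by simp
  have lj: "real l = real k * real (n choose k) * real j" using j by simp
  have "real n * (real (n choose k) * real j) = real n * (real (m choose k) * real i)"
    using li lj pos(3) by (simp add: mult.assoc)
  also have "\<dots> = (real n - real k) * real (n choose k) * real i" using e2 by (simp add: mult.assoc[symmetric])
  finally have "real n * real j = (real n - real k) * real i" using pos(1) by (simp add: mult.left_commute mult.assoc)
  then have "(real n - real k) * (real i - real j) = real k * real j" by (simp add: algebra_simps)
  then have "real (n choose k) * ((real n - real k) * (real i - real j)) = real (n choose k) * (real k * real j)"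
    by simp
  \<comment> \<open>The cofactor of \<open>l\<close> is \<open>i - j\<close>. It is carried through
    the reals into the integers because subtraction of naturals would truncate.\<close>
  then have "real l = (real (Suc k) * real (n choose Suc k)) * (real i - real j)"
    unfolding e1 lj by (simp only: ac_simps)
  then have "real_of_int (int l) = real_of_int (int (Suc k * (n choose Suc k)) * (int i - int j))"
    by (simp only: of_int_mult of_int_diff of_int_of_nat_eq of_nat_mult)
  then have "int l = int (Suc k * (n choose Suc k)) * (int i - int j)" by (simp only: of_int_eq_iff)
  then have "int (Suc k * (n choose Suc k)) dvd int l" by simp
  then show ?case unfolding l_def by (simp only: int_dvd_int_iff)
qed

text \<open>The least common multiple divides the product of the largest powers
  \<open>p ^ e p \<le> N\<close> over the primes \<open>p \<le> N\<close>, and each factor is at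
  most \<open>N\<close>.\<close>

lemma Lcm_upto_le:
  assumes "N \<ge> 1"
  shows "(Lcm {1..N} :: nat) \<le> N ^ card (primes_in 0 (real N))"
proof -
  define P where "P = primes_in 0 (real N)"
  have P: "p \<in> P \<longleftrightarrow> prime p \<and> p \<le> N" for p
    unfolding P_def primes_in_def using prime_gt_0_nat by auto
  define e where "e p = (GREATEST k. p ^ k \<le> N)" for p
  have e: "p ^ e p \<le> N \<and> (\<forall>k. p ^ k \<le> N \<longrightarrow> k \<le> e p)" if "prime p" for p
  proof -
    have b: "k \<le> N" if "p ^ k \<le> N" for k
    proof -
      have "k < p ^ k" using prime_gt_1_nat[OF \<open>prime p\<close>] by (intro power_gt_expt) simp
      then show ?thesis using that by simp
    qed
    have "p ^ 0 \<le> N" using assms by simp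
    then have "p ^ e p \<le> N" unfolding e_def by (rule GreatestI_nat[of "\<lambda>k. p ^ k \<le> N"]) (rule b)
    moreover have "k \<le> e p" if "p ^ k \<le> N" for k
      unfolding e_def using that by (rule Greatest_le_nat[of "\<lambda>k. p ^ k \<le> N"]) (rule b)
    ultimately show ?thesis by simp
  qed
  have "Lcm {1..N} dvd (\<Prod>p\<in>P. p ^ e p)"
  proof (rule Lcm_least)
    fix m assume m: "m \<in> {1..N}"
    have "m = (\<Prod>p\<in>prime_factors m. p ^ multiplicity p m)"
      using m by (simp add: prime_factorization_nat[symmetric])
    also have "\<dots> dvd (\<Prod>p\<in>P. p ^ e p)"
    proof (rule prod_dvd_prod_subset2)
      show "prime_factors m \<subseteq> P"
      proof
        fix p assume "p \<in> prime_factors m"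
        then have "prime p" "p dvd m" by (auto simp: in_prime_factors_iff)
        moreover have "p \<le> m" using \<open>p dvd m\<close> m by (intro dvd_imp_le) auto
        ultimately show "p \<in> P" using m P by simp
      qed
      fix p assume p: "p \<in> prime_factors m"
      have "p ^ multiplicity p m \<le> m" using m by (intro dvd_imp_le multiplicity_dvd) auto
      then have "p ^ multiplicity p m \<le> N" using m by simp
      moreover have "prime p" using p by (simp add: in_prime_factors_iff)
      ultimately have "multiplicity p m \<le> e p" using e by blast
      then show "p ^ multiplicity p m dvd p ^ e p" by (rule le_imp_power_dvd)
    qed (simp add: P_def)
    finally show "m dvd (\<Prod>p\<in>P. p ^ e p)" .
  qed
  moreover have "(\<Prod>p\<in>P. p ^ e p) > 0" by (rule prod_pos) (auto simp: P prime_gt_0_nat)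
  ultimately have "Lcm {1..N} \<le> (\<Prod>p\<in>P. p ^ e p)" by (rule dvd_imp_le)
  also have "\<dots> \<le> (\<Prod>p\<in>P. N)" by (rule prod_mono) (use e P in auto)
  also have "\<dots> = N ^ card P" by simp
  finally show ?thesis unfolding P_def .
qed

text \<open>With \<open>n\<close> the integer part of \<open>y/2\<close>, the number
  \<open>n * (2*n choose n)\<close> is at least \<open>4 ^ n / 2\<close> and divides the least
  common multiple of \<open>{1..2*n}\<close>, which \<open>Lcm_upto_le\<close> bounds. The losses 1
  and \<open>ln 2\<close> come from rounding and from the central binomial bound.\<close>

lemma card_primes_lower:
  fixes y :: real
  assumes "y \<ge> 2"
  shows "(y/2 - 1) * ln 4 - ln 2 \<le> real (card (primes_in 0 y)) * ln y"
proof -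
  define n where "n = nat \<lfloor>y/2\<rfloor>"
  have n: "n \<ge> 1" "real n \<le> y/2" "y/2 < real n + 1" unfolding n_def using assms by linarith+
  have "n * (2*n choose n) \<le> Lcm {1..2*n}"
    using n by (intro dvd_imp_le mult_binomial_dvd_Lcm) (auto simp: Lcm_0_iff_nat intro!: Nat.gr0I)
  also have "\<dots> \<le> (2*n) ^ card (primes_in 0 (real (2*n)))" using n by (intro Lcm_upto_le) auto
  also have "\<dots> \<le> (2*n) ^ card (primes_in 0 y)"
    using n by (intro power_increasing card_mono finite_primes_in primes_in_mono) auto
  finally have "real n * real (2*n choose n) \<le> real ((2*n) ^ card (primes_in 0 y))"
    by (simp only: of_nat_mult[symmetric] of_nat_le_iff)
  moreover have "4 ^ n / 2 \<le> real n * real (2*n choose n)"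
    using central_binomial_lower_bound[of n] n by (simp add: field_simps)
  ultimately have "4 ^ n / 2 \<le> real (2*n) ^ card (primes_in 0 y)" by simp
  also have "\<dots> \<le> y ^ card (primes_in 0 y)" using n by (intro power_mono) auto
  finally have "ln (4 ^ n / 2) \<le> ln (y ^ card (primes_in 0 y))"
    using assms by (subst ln_le_cancel_iff) auto
  then have "real n * ln 4 - ln 2 \<le> real (card (primes_in 0 y)) * ln y"
    using assms by (simp add: ln_div ln_realpow)
  moreover have "(y/2 - 1) * ln 4 \<le> real n * ln 4" using n by (intro mult_right_mono) auto
  ultimately show ?thesis by linarith
qed

lemma prod_primes_dvd:
  fixes m :: nat
  assumes "finite P" "\<And>p. p \<in> P \<Longrightarrow> prime p" "\<And>p. p \<in> P \<Longrightarrow> p dvd m"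
  shows "\<Prod>P dvd m"
  using assms
proof (induction P rule: finite_induct)
  case (insert p P)
  have "coprime p (\<Prod>P)"
    using insert by (intro prod_coprime_right) (metis insertCI primes_coprime)
  then show ?case using insert by (simp add: divides_mult)
qed simp

text \<open>These primes divide \<open>fact n\<close> but neither \<open>fact k\<close> nor
  \<open>fact (n - k)\<close>, so each of them, and hence their product, divides the binomial
  coefficient.\<close>

lemma prod_primes_le_binomial:
  assumes "\<And>p. p \<in> P \<Longrightarrow> prime p \<and> n - k < p \<and> p \<le> n \<and> k < p" and "k \<le> n"
  shows "\<Prod>P \<le> (n choose k)"
proof (rule dvd_imp_le[OF prod_primes_dvd])
  show "finite P" by (rule finite_subset[of _ "{..n}"]) (use assms in auto)
  fix p assume "p \<in> P"
  then have p: "prime p" "n - k < p" "p \<le> n" "k < p" using assms by auto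
  have "p dvd fact n" using p by (simp add: prime_dvd_fact_iff)
  then have "p dvd fact k * fact (n - k) * (n choose k)" using binomial_fact_lemma[OF assms(2)] by simp
  then show "p dvd (n choose k)"
    using p by (auto simp: prime_dvd_mult_iff prime_dvd_fact_iff)
qed (use assms in auto)

text \<open>Erdos's induction: the primes between \<open>2 ^ k\<close> and \<open>2 ^ Suc k\<close>
  divide a central binomial coefficient, which is at most \<open>4 ^ 2 ^ k\<close>, and the
  exponents double. Powers of 2 avoid all rounding and cost only a factor 2 later.\<close>

lemma primorial_pow2_le: "\<Prod>(primes_in 0 (2 ^ k)) \<le> 4 ^ 2 ^ k"
proof (induction k)
  case 0
  have "primes_in 0 1 = {}" by (auto simp: primes_in_def dest: prime_gt_1_nat)
  then show ?case by simp
next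
  case (Suc k)
  define n :: nat where "n = 2 ^ k"
  have split: "primes_in 0 (2 ^ Suc k) = primes_in 0 (2 ^ k) \<union> primes_in (2 ^ k) (2 ^ Suc k)"
    by (rule primes_in_split) auto
  have "\<Prod>(primes_in (2 ^ k) (2 ^ Suc k)) \<le> (2*n choose n)"
  proof (rule prod_primes_le_binomial)
    fix p assume "p \<in> primes_in (2 ^ k) (2 ^ Suc k)"
    then have "prime p" "real n < real p" "real p \<le> real (2*n)" by (auto simp: primes_in_def n_def)
    then show "prime p \<and> 2*n - n < p \<and> p \<le> 2*n \<and> n < p" by linarith
  qed simp
  also have "\<dots> \<le> 4 ^ n" using binomial_le_pow2[of "2*n" n] by (simp add: power_mult)
  finally have "\<Prod>(primes_in 0 (2 ^ k)) * \<Prod>(primes_in (2 ^ k) (2 ^ Suc k)) \<le> 4 ^ n * 4 ^ n"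
    using Suc.IH unfolding n_def by (intro mult_le_mono)
  moreover have "\<Prod>(primes_in 0 (2 ^ Suc k)) = \<Prod>(primes_in 0 (2 ^ k)) * \<Prod>(primes_in (2 ^ k) (2 ^ Suc k))"
    unfolding split by (rule prod.union_disjoint[OF finite_primes_in finite_primes_in]) (auto simp: primes_in_def)
  moreover have "n + n = 2 ^ Suc k" by (simp add: n_def)
  ultimately show ?case by (metis power_add)
qed

lemma card_primes_mult_ln_le:
  fixes x :: real
  assumes "finite P" "x > 0" "\<And>p. p \<in> P \<Longrightarrow> x \<le> real p" "real (\<Prod>P) \<le> z"
  shows "real (card P) * ln x \<le> ln z"
proof -
  have "x ^ card P = (\<Prod>p\<in>P. x)" by simp
  also have "\<dots> \<le> (\<Prod>p\<in>P. real p)" using assms by (intro prod_mono) auto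
  also have "\<dots> \<le> z" using assms(4) by simp
  finally have "x ^ card P \<le> z" .
  moreover have "0 < x ^ card P" using assms(2) by simp
  ultimately have "ln (x ^ card P) \<le> ln z" by (meson ln_le_cancel_iff less_le_trans)
  then show ?thesis using assms(2) by (simp add: ln_realpow)
qed

text \<open>Up to \<open>sqrt y\<close> all integers are counted. Each larger prime contributes at
  least \<open>ln y / 2\<close> to the logarithm of the primorial at a power of 2 below
  \<open>2 * y\<close>.\<close>

lemma card_primes_upper:
  fixes y :: real
  assumes "y > 1"
  shows "real (card (primes_in 0 y)) \<le> sqrt y + 4 * ln 4 * y / ln y"
proof -
  define k where "k = nat \<lceil>log 2 y\<rceil>"
  have k: "log 2 y \<le> real k" "real k < log 2 y + 1"
    unfolding k_def using assms zero_less_log_cancel_iff[of 2 y] by linarith+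
  have "2 powr (log 2 y) \<le> 2 powr (real k)" "2 powr (real k) < 2 powr (log 2 y + 1)"
    using k by (auto intro: powr_mono)
  then have k2: "y \<le> 2 ^ k" "2 ^ k < 2 * y"
    using assms by (auto simp: powr_realpow powr_add)
  have sub: "primes_in (sqrt y) y \<subseteq> primes_in 0 (2 ^ k)"
    using k2 assms by (intro primes_in_mono) auto
  have "\<Prod>(primes_in (sqrt y) y) \<le> \<Prod>(primes_in 0 (2 ^ k))"
    using sub by (intro dvd_imp_le prod_dvd_prod_subset prod_pos) (auto simp: primes_in_def)
  also have "\<dots> \<le> 4 ^ 2 ^ k" by (rule primorial_pow2_le)
  finally have "real (\<Prod>(primes_in (sqrt y) y)) \<le> real (4 ^ 2 ^ k)" by (simp only: of_nat_le_iff)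
  then have "real (\<Prod>(primes_in (sqrt y) y)) \<le> 4 ^ 2 ^ k" by simp
  then have "real (card (primes_in (sqrt y) y)) * ln (sqrt y) \<le> ln (4 ^ 2 ^ k)"
    using assms by (intro card_primes_mult_ln_le finite_primes_in) (auto simp: primes_in_def)
  also have "\<dots> = 2 ^ k * ln 4" by (simp add: ln_realpow)
  also have "\<dots> \<le> 2 * y * ln 4" using k2 by (intro mult_right_mono) auto
  finally have "real (card (primes_in (sqrt y) y)) \<le> 4 * ln 4 * y / ln y"
    using assms by (simp add: ln_sqrt field_simps)
  moreover have "real (card (primes_in 0 (sqrt y))) \<le> sqrt y"
  proof -
    have "primes_in 0 (sqrt y) \<subseteq> {1..nat \<lfloor>sqrt y\<rfloor>}"
      by (auto simp: primes_in_def le_nat_floor prime_ge_1_nat)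
    then have "card (primes_in 0 (sqrt y)) \<le> nat \<lfloor>sqrt y\<rfloor>"
      using card_mono[of "{1..nat \<lfloor>sqrt y\<rfloor>}"] by fastforce
    then show ?thesis using assms by (simp add: le_nat_iff le_floor_iff)
  qed
  moreover have "card (primes_in 0 y) \<le> card (primes_in 0 (sqrt y)) + card (primes_in (sqrt y) y)"
    using assms by (subst primes_in_split[of 0 "sqrt y"]) (auto intro!: card_Un_le real_le_lsqrt self_le_power)
  ultimately show ?thesis by linarith
qed

text \<open>The ratio 64 is generous: the lower bound at \<open>64 * x\<close> is asymptotically
  \<open>32 * ln 4 * x / ln x\<close>, the upper bound at \<open>x\<close> only
  \<open>4 * ln 4 * x / ln x\<close>.\<close>

lemma eventually_card_primes_block:
  "\<forall>\<^sub>F x in at_top. x / ln x \<le> real (card (primes_in x (64 * x)))"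
proof -
  \<comment> \<open>This is what remains to be shown once \<open>ln 2 \<le> 1 \<le> ln 4\<close> has
    been used to take a factor \<open>ln 4\<close> out of both sides.\<close>
  have ev: "\<forall>\<^sub>F x::real in at_top. 5 * x / ln x + sqrt x \<le> (32 * x - 2) / ln (64 * x)"
    by real_asymp
  have ln4: "1 \<le> ln (4::real)"
    using exp_le by (subst ln_ge_iff) auto
  have ln2: "ln (2::real) \<le> 1" using ln_le_minus_one[of "2::real"] by simp
  show ?thesis using ev eventually_gt_at_top[of 2]
  proof eventually_elim
    case (elim x)
    have "((64*x/2 - 1) * ln 4 - ln 2) / ln (64*x) \<le> real (card (primes_in 0 (64*x)))"
      using card_primes_lower[of "64*x"] elim(2) by (subst pos_divide_le_eq) auto
    moreover have "real (card (primes_in 0 x)) \<le> sqrt x + 4 * ln 4 * x / ln x"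
      using card_primes_upper[of x] elim by simp
    moreover have "card (primes_in 0 (64*x)) \<le> card (primes_in 0 x) + card (primes_in x (64*x))"
      using elim(2) by (subst primes_in_split[of 0 x]) (auto intro: card_Un_le)
    moreover have "x / ln x + (sqrt x + 4 * ln 4 * x / ln x) \<le> ((64*x/2 - 1) * ln 4 - ln 2) / ln (64*x)"
    proof -
      have "x / ln x + (sqrt x + 4 * ln 4 * x / ln x) \<le> ln 4 * (x / ln x) + (ln 4 * sqrt x + 4 * ln 4 * x / ln x)"
        using ln4 elim(2) mult_right_mono[OF ln4, of "x / ln x"] mult_right_mono[OF ln4, of "sqrt x"]
        by (intro add_mono) auto
      also have "\<dots> = ln 4 * (5 * x / ln x + sqrt x)" by (simp add: algebra_simps)
      also have "\<dots> \<le> ln 4 * ((32 * x - 2) / ln (64 * x))" using elim(1) by (intro mult_left_mono) auto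
      also have "\<dots> = ((64*x/2 - 1) * ln 4 - ln 4) / ln (64*x)" by (simp add: algebra_simps diff_divide_distrib)
      also have "\<dots> \<le> ((64*x/2 - 1) * ln 4 - ln 2) / ln (64*x)"
        using ln4 ln2 elim(2) by (intro divide_right_mono) auto
      finally show ?thesis .
    qed
    ultimately show ?case by linarith
  qed
qed

section \<open>Few primes in short intervals\<close>

text \<open>A single term of the expansion of \<open>(t + 1) ^ n\<close>. A small \<open>t\<close>
  makes the bound useful when \<open>k\<close> is small compared to \<open>n\<close>.\<close>

lemma binomial_le_exponential:
  fixes t :: real
  assumes "t > 0" "k \<le> n"
  shows "real (n choose k) \<le> (1 + t) ^ n / t ^ k"
proof -
  have "real (n choose k) * t ^ k \<le> (\<Sum>k\<le>n. real (n choose k) * t ^ k * 1 ^ (n - k))"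
    using assms by (intro order_trans[OF _ member_le_sum[of k]]) auto
  also have "\<dots> = (t + 1) ^ n" by (simp add: binomial_ring)
  finally show ?thesis using assms by (simp add: field_simps)
qed

text \<open>
  The primes in \<open>[y, (1+\<delta>)y]\<close> divide a binomial coefficient whose logarithm is \<open>O(\<delta> log (1/\<delta>) y)\<close>; the
  constant tends to 0 with \<open>\<delta>\<close>, which is all that is needed instead of the prime number theorem.
\<close>

lemma eventually_card_primes_short:
  fixes \<epsilon> :: real
  assumes "\<epsilon> > 0"
  obtains \<delta> where "\<delta> > 0"
    "\<forall>\<^sub>F x in at_top. \<forall>y\<in>{x..64*x}. real (card {p. prime p \<and> y \<le> real p \<and> real p \<le> (1 + \<delta>) * y}) \<le> \<epsilon> * (x / ln x)"
proof -
  \<comment> \<open>The logarithm of the binomial coefficient will be at most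
    \<open>2 * y * t + (\<delta> * y + 1) * l\<close>. First \<open>t\<close>, then
    \<open>\<delta>\<close>, is chosen to keep the part proportional to
    \<open>y \<le> 64 * x\<close> below \<open>\<epsilon> * x / 2\<close>; the leftover
    \<open>l\<close> is at most \<open>\<epsilon> * x / 2\<close> for large
    \<open>x\<close>.\<close>
  define t where "t = min (1/2) (\<epsilon> / 512)"
  have t: "0 < t" "t \<le> 1/2" "t \<le> \<epsilon> / 512" using assms by (auto simp: t_def)
  define l where "l = ln (1/t)"
  have l: "l > 0" unfolding l_def using t by (intro ln_gt_zero) (auto simp: field_simps)
  define \<delta> where "\<delta> = min (1/2) (\<epsilon> / (256 * l))"
  have \<delta>: "0 < \<delta>" "\<delta> \<le> 1/2" "\<delta> \<le> \<epsilon> / (256*l)" using assms l by (auto simp: \<delta>_def)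
  have \<delta>l: "256 * (\<delta> * l) \<le> \<epsilon>" using \<delta>(3) l by (simp add: field_simps)
  have "\<forall>\<^sub>F x in at_top. \<forall>y\<in>{x..64*x}. real (card {p. prime p \<and> y \<le> real p \<and> real p \<le> (1 + \<delta>) * y}) \<le> \<epsilon> * (x / ln x)"
    using eventually_gt_at_top[of 4] eventually_gt_at_top[of "2 * l / \<epsilon>"]
  proof eventually_elim
    case (elim x)
    show ?case
    proof
      fix y assume y: "y \<in> {x..64*x}"
      define P where "P = {p. prime p \<and> y \<le> real p \<and> real p \<le> (1 + \<delta>) * y}"
      define n where "n = nat \<lfloor>(1 + \<delta>) * y\<rfloor>"
      \<comment> \<open>The largest integer below \<open>y\<close>, so that a prime equal to
        \<open>y\<close> still exceeds \<open>m = n - k\<close>.\<close>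
      define m where "m = nat \<lceil>y\<rceil> - 1"
      have y4: "y > 4" using y elim by auto
      have y1: "y \<le> (1 + \<delta>) * y" "(1 + \<delta>) * y \<le> y + y / 2" using y4 \<delta> by (auto simp: algebra_simps)
      have n: "real n \<le> (1 + \<delta>) * y" "(1 + \<delta>) * y < real n + 1" unfolding n_def using y1 y4 by linarith+
      have m: "real m < y" "y \<le> real m + 1" unfolding m_def using y4 by linarith+
      have n2: "real n \<le> 2 * y" using n y1 y4 by linarith
      have mn: "m \<le> n" using m n y1 by linarith
      define k where "k = n - m"
      have k: "real k = real n - real m" unfolding k_def using mn by simp
      have k1: "real k \<le> \<delta> * y + 1" using k n m by (simp add: algebra_simps)
      \<comment> \<open>Hence the primes counted exceed \<open>k\<close>, as
        \<open>prod_primes_le_binomial\<close> requires. This rests on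
        \<open>\<delta> \<le> 1/2\<close> and \<open>y > 4\<close>.\<close>
      have ky: "real k < y" using k n m y1 y4 by linarith
      have fin: "finite P" unfolding P_def
        by (rule finite_subset[of _ "{..n}"]) (auto simp: n_def le_nat_floor)
      have "\<Prod>P \<le> (n choose k)"
      proof (rule prod_primes_le_binomial)
        fix p assume "p \<in> P"
        then have p: "prime p" "y \<le> real p" "real p \<le> (1 + \<delta>) * y" by (auto simp: P_def)
        have "real m < real p" using m p by linarith
        moreover have "real p < real n + 1" using n p by linarith
        moreover have "real k < real p" using ky p by linarith
        ultimately show "prime p \<and> n - k < p \<and> p \<le> n \<and> k < p" using p(1) mn unfolding k_def by auto
      qed (simp add: k_def)
      then have "real (\<Prod>P) \<le> real (n choose k)" by (simp only: of_nat_le_iff)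
      also have "\<dots> \<le> (1 + t) ^ n / t ^ k" using t by (intro binomial_le_exponential) (auto simp: k_def)
      finally have "real (card P) * ln y \<le> ln ((1 + t) ^ n / t ^ k)"
        using fin y4 by (intro card_primes_mult_ln_le) (auto simp: P_def)
      also have "\<dots> = real n * ln (1 + t) + real k * l"
        unfolding l_def using t by (simp add: ln_div ln_realpow)
      also have "\<dots> \<le> real n * t + real k * l"
        using t by (intro add_right_mono mult_left_mono ln_add_one_self_le_self) auto
      also have "\<dots> \<le> (2 * y) * t + (\<delta> * y + 1) * l"
        using n2 k1 l t by (intro add_mono mult_right_mono) auto
      also have "\<dots> = y * (2 * t + \<delta> * l) + l" by (simp add: algebra_simps)
      also have "\<dots> \<le> (64 * x) * (\<epsilon> / 128) + \<epsilon> * x / 2"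
      proof (rule add_mono)
        show "y * (2 * t + \<delta> * l) \<le> (64 * x) * (\<epsilon> / 128)"
          using y t \<delta>l \<delta> l elim by (intro mult_mono) auto
        show "l \<le> \<epsilon> * x / 2" using elim(2) assms by (simp add: field_simps)
      qed
      also have "\<dots> = \<epsilon> * x" by simp
      finally have "real (card P) * ln y \<le> \<epsilon> * x" .
      moreover have "real (card P) * ln x \<le> real (card P) * ln y"
        using y elim by (intro mult_left_mono) auto
      ultimately show "real (card P) \<le> \<epsilon> * (x / ln x)"
        using elim by (simp add: field_simps)
    qed
  qed
  then show ?thesis using that \<delta>(1) by blast
qed

section \<open>Directions of complex powers of primes\<close>

text \<open>Subtracting the nearest multiple of \<open>pi\<close> changes the sine at most in sign
  and leads to \<open>[-pi/2, pi/2]\<close>, where the sine is monotone.\<close>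

lemma abs_sin_less_imp_near_pi_multiple:
  fixes t \<eta> :: real
  assumes "\<bar>sin t\<bar> < sin \<eta>" "0 < \<eta>" "\<eta> < pi/2"
  obtains k :: int where "\<bar>t - of_int k * pi\<bar> < \<eta>"
proof -
  define k where "k = round (t / pi)"
  define s where "s = t - of_int k * pi"
  have "\<bar>of_int k - t / pi\<bar> \<le> 1/2" unfolding k_def by (rule of_int_round_abs_le)
  then have "\<bar>of_int k - t / pi\<bar> * pi \<le> 1/2 * pi" by (intro mult_right_mono) auto
  also have "\<bar>of_int k - t / pi\<bar> * pi = \<bar>(of_int k - t / pi) * pi\<bar>" by (simp add: abs_mult)
  also have "(of_int k - t / pi) * pi = - s" by (simp add: s_def field_simps)
  finally have s: "\<bar>s\<bar> \<le> pi/2" by simp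
  have "sin t = sin s * cos (of_int k * pi) + cos s * sin (of_int k * pi)"
    unfolding sin_add[symmetric] by (simp add: s_def)
  then have "\<bar>sin t\<bar> = \<bar>sin s\<bar>"
    by (simp add: abs_mult sin_times_pi_eq_0 mult.commute[of _ pi] cos_npi_int)
  moreover have "\<bar>sin s\<bar> = sin \<bar>s\<bar>"
  proof (cases "s \<ge> 0")
    case True
    then show ?thesis using s sin_ge_zero[of s] by simp
  next
    case False
    then show ?thesis using s sin_ge_zero[of "-s"] by simp
  qed
  ultimately have "sin \<bar>s\<bar> < sin \<eta>" using assms by simp
  moreover have "sin \<eta> \<le> sin \<bar>s\<bar>" if "\<eta> \<le> \<bar>s\<bar>"
    using that s assms by (intro sin_monotone_2pi_le) auto
  ultimately have "\<bar>s\<bar> < \<eta>" by linarith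
  then show ?thesis using that[of k] by (simp add: s_def)
qed

text \<open>The powers of \<open>p\<close> and \<open>q\<close> point along nearly the same line
  when \<open>b * ln (p / q)\<close> is close to a multiple of \<open>pi\<close>. Within a block
  boundedly many multiples occur, and each confines \<open>q\<close> to a short interval. By
  \<open>eventually_card_primes_block\<close> the bound is at most half of the block.\<close>

lemma eventually_few_aligned_primes:
  fixes b :: real
  assumes "b \<noteq> 0"
  obtains \<delta> where "\<delta> > 0" "\<forall>\<^sub>F x in at_top. \<forall>p\<in>primes_in x (64*x).
    real (card {q\<in>primes_in x (64*x). \<bar>sin (b * ln (real p / real q))\<bar> < \<delta>}) \<le> (x / ln x) / 2"
proof -
  \<comment> \<open>All multiples \<open>k * pi\<close> that occur have \<open>|k| < B\<close>. The
    \<open>2 * B + 1\<close> classes get a share \<open>\<epsilon>\<close> each, which adds up to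
    one half.\<close>
  define B :: nat where "B = nat \<lceil>\<bar>b\<bar> * ln 64\<rceil> + 1"
  define \<epsilon> :: real where "\<epsilon> = 1 / (2 * (2 * real B + 1))"
  have "\<epsilon> > 0" by (simp add: \<epsilon>_def add_pos_nonneg)
  then obtain \<delta> where \<delta>: "\<delta> > 0" and ev: "\<forall>\<^sub>F x in at_top. \<forall>y\<in>{x..64*x}.
      real (card {p. prime p \<and> y \<le> real p \<and> real p \<le> (1 + \<delta>) * y}) \<le> \<epsilon> * (x / ln x)"
    by (rule eventually_card_primes_short)
  \<comment> \<open>For two primes \<open>q\<close>, \<open>r\<close> of one class
    \<open>|b * ln (q / r)| < 2 * \<eta>\<close>, so their ratio is below
    \<open>1 + \<delta>\<close>. The bound 1 accounts for the extra 1 in \<open>B\<close>.\<close>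
  define \<eta> where "\<eta> = min 1 (\<bar>b\<bar> * ln (1 + \<delta>) / 2)"
  have \<eta>: "0 < \<eta>" "\<eta> \<le> 1" "\<eta> < pi/2" "2 * \<eta> \<le> \<bar>b\<bar> * ln (1 + \<delta>)"
    using assms \<delta> pi_gt3 by (auto simp: \<eta>_def min_def)
  have "sin \<eta> > 0" using \<eta> by (intro sin_gt_zero) auto
  moreover have "\<forall>\<^sub>F x in at_top. \<forall>p\<in>primes_in x (64*x).
    real (card {q\<in>primes_in x (64*x). \<bar>sin (b * ln (real p / real q))\<bar> < sin \<eta>}) \<le> (x / ln x) / 2"
    using ev eventually_gt_at_top[of 1]
  proof eventually_elim
    case (elim x)
    show ?case
    proof
      fix p assume p: "p \<in> primes_in x (64*x)"
      define S where "S k = {q\<in>primes_in x (64*x). \<bar>b * ln (real p / real q) - of_int k * pi\<bar> < \<eta>}" for k :: int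
      have "{q\<in>primes_in x (64*x). \<bar>sin (b * ln (real p / real q))\<bar> < sin \<eta>} \<subseteq> (\<Union>k\<in>{- int B..int B}. S k)"
      proof
        fix q assume "q \<in> {q\<in>primes_in x (64*x). \<bar>sin (b * ln (real p / real q))\<bar> < sin \<eta>}"
        then have q: "q \<in> primes_in x (64*x)" "\<bar>sin (b * ln (real p / real q))\<bar> < sin \<eta>" by auto
        obtain k :: int where k: "\<bar>b * ln (real p / real q) - of_int k * pi\<bar> < \<eta>"
          by (rule abs_sin_less_imp_near_pi_multiple[OF q(2) \<eta>(1,3)])
        have pq: "x < real p" "real p \<le> 64 * x" "x < real q" "real q \<le> 64 * x"
          using p q by (auto simp: primes_in_def)
        then have "ln (real p) \<le> ln (64 * x)" "ln (real q) \<le> ln (64 * x)" "ln x \<le> ln (real p)" "ln x \<le> ln (real q)"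
          using elim(2) by auto
        moreover have "ln (64 * x) = ln 64 + ln x" using elim(2) by (simp add: ln_mult)
        moreover have "ln (real p / real q) = ln (real p) - ln (real q)" using pq elim(2) by (simp add: ln_div)
        ultimately have "\<bar>ln (real p / real q)\<bar> \<le> ln 64" by linarith
        then have "\<bar>b * ln (real p / real q)\<bar> \<le> \<bar>b\<bar> * ln 64" by (simp add: abs_mult mult_left_mono)
        then have "\<bar>of_int k * pi\<bar> < real B" using k \<eta>(2) unfolding B_def by linarith
        moreover have "\<bar>of_int k\<bar> * 1 \<le> \<bar>of_int k\<bar> * pi" using pi_gt3 by (intro mult_left_mono) auto
        ultimately have "\<bar>real_of_int k\<bar> < real B" by (simp add: abs_mult)
        then have "k \<in> {- int B..int B}" by auto
        then show "q \<in> (\<Union>k\<in>{- int B..int B}. S k)" using q(1) k by (auto simp: S_def)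
      qed
      then have "card {q\<in>primes_in x (64*x). \<bar>sin (b * ln (real p / real q))\<bar> < sin \<eta>} \<le> card (\<Union>k\<in>{- int B..int B}. S k)"
        by (rule card_mono[rotated]) (auto simp: S_def)
      also have "\<dots> \<le> (\<Sum>k\<in>{- int B..int B}. card (S k))" by (rule card_UN_le) simp
      finally have "real (card {q\<in>primes_in x (64*x). \<bar>sin (b * ln (real p / real q))\<bar> < sin \<eta>})
          \<le> (\<Sum>k\<in>{- int B..int B}. real (card (S k)))" by (simp only: of_nat_sum[symmetric] of_nat_le_iff)
      also have "\<dots> \<le> (\<Sum>k\<in>{- int B..int B}. \<epsilon> * (x / ln x))"
      proof (rule sum_mono)
        fix k assume "k \<in> {- int B..int B}"
        have fin: "finite (S k)" by (simp add: S_def)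
        show "real (card (S k)) \<le> \<epsilon> * (x / ln x)"
        proof (cases "S k = {}")
          case True
          then show ?thesis using \<open>\<epsilon> > 0\<close> elim(2) by simp
        next
          case False
          define r where "r = Min (S k)"
          have r: "r \<in> S k" "\<And>q. q \<in> S k \<Longrightarrow> r \<le> q" using False fin by (auto simp: r_def)
          have r0: "x < real r" "real r \<le> 64 * x" using r(1) by (auto simp: S_def primes_in_def)
          have "S k \<subseteq> {q. prime q \<and> real r \<le> real q \<and> real q \<le> (1 + \<delta>) * real r}"
          proof
            fix q assume q: "q \<in> S k"
            have pos: "0 < real p" "0 < real q" "0 < real r" using p q r0 elim(2) by (auto simp: S_def primes_in_def)
            have "b * ln (real q / real r) = b * ln (real p / real r) - b * ln (real p / real q)"
              using pos by (simp add: ln_div algebra_simps)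
            moreover have "\<bar>b * ln (real p / real q) - of_int k * pi\<bar> < \<eta>" "\<bar>b * ln (real p / real r) - of_int k * pi\<bar> < \<eta>"
              using q r(1) by (auto simp: S_def)
            ultimately have "\<bar>b * ln (real q / real r)\<bar> < 2 * \<eta>" by linarith
            also note \<eta>(4)
            finally have "\<bar>b * ln (real q / real r)\<bar> < \<bar>b\<bar> * ln (1 + \<delta>)" .
            moreover have "\<bar>b\<bar> * ln (real q / real r) \<le> \<bar>b * ln (real q / real r)\<bar>"
              unfolding abs_mult by (intro mult_left_mono) auto
            ultimately have "\<bar>b\<bar> * ln (real q / real r) < \<bar>b\<bar> * ln (1 + \<delta>)" by linarith
            then have "ln (real q / real r) < ln (1 + \<delta>)" using assms by simp
            then have "real q / real r < 1 + \<delta>" using pos \<delta> by (subst (asm) ln_less_cancel_iff) auto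
            then have "real q \<le> (1 + \<delta>) * real r" using pos by (simp add: field_simps)
            then show "q \<in> {q. prime q \<and> real r \<le> real q \<and> real q \<le> (1 + \<delta>) * real r}"
              using q r(2)[OF q] by (auto simp: S_def primes_in_def)
          qed
          moreover have "finite {q. prime q \<and> real r \<le> real q \<and> real q \<le> (1 + \<delta>) * real r}"
            by (rule finite_subset[of _ "{..nat \<lfloor>(1 + \<delta>) * real r\<rfloor>}"]) (auto simp: le_nat_floor)
          ultimately have "card (S k) \<le> card {q. prime q \<and> real r \<le> real q \<and> real q \<le> (1 + \<delta>) * real r}"
            by (intro card_mono)
          then have "real (card (S k)) \<le> real (card {q. prime q \<and> real r \<le> real q \<and> real q \<le> (1 + \<delta>) * real r})"
            by simp
          also have "\<dots> \<le> \<epsilon> * (x / ln x)" by (rule bspec[OF elim(1)]) (use r0 in simp)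
          finally show ?thesis .
        qed
      qed
      also have "\<dots> = (2 * real B + 1) * \<epsilon> * (x / ln x)" by simp
      also have "(2 * real B + 1) * \<epsilon> = 1/2" by (simp add: \<epsilon>_def field_simps)
      finally show "real (card {q\<in>primes_in x (64*x). \<bar>sin (b * ln (real p / real q))\<bar> < sin \<eta>}) \<le> (x / ln x) / 2"
        by simp
    qed
  qed
  ultimately show ?thesis using that by blast
qed

section \<open>Choice of the pairs of primes\<close>

lemma disjoint_pairs_exist:
  assumes "finite S" "4 * L \<le> card S"
    and "\<And>p. p \<in> S \<Longrightarrow> 2 * card {q\<in>S. \<not> R p q} \<le> card S"
  shows "\<exists>f :: nat \<Rightarrow> 'a. inj_on f {..<2*L} \<and> f ` {..<2*L} \<subseteq> S \<and> (\<forall>t<L. R (f (2*t)) (f (Suc (2*t))))"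
  using assms(2)
proof (induction L)
  case 0
  show ?case by simp
next
  case (Suc L)
  then obtain f :: "nat \<Rightarrow> 'a" where f: "inj_on f {..<2*L}" "f ` {..<2*L} \<subseteq> S" "\<forall>t<L. R (f (2*t)) (f (Suc (2*t)))"
    by auto
  define U where "U = f ` {..<2*L}"
  have U: "finite U" "card U = 2*L" "U \<subseteq> S" using f by (auto simp: U_def card_image)
  have "card U < card S" using U Suc.prems by simp
  then obtain p where p: "p \<in> S" "p \<notin> U" using U by (metis card_mono leD subsetI U(1))
  define bad where "bad = {q\<in>S. \<not> R p q}"
  have "card (insert p U \<union> bad) \<le> Suc (2*L) + card bad"
    using card_Un_le[of "insert p U" bad] card_insert_le_m1[of "Suc (2*L)" U p] U p by simp
  also have "\<dots> < card S" using assms(3)[OF p(1)] Suc.prems unfolding bad_def by arith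
  finally have "\<not> S \<subseteq> insert p U \<union> bad"
    using U assms(1) by (metis bad_def card_mono finite_Un finite_insert finite_Collect_conjI leD Collect_mem_eq)
  then obtain q where q: "q \<in> S" "q \<noteq> p" "q \<notin> U" "R p q" by (auto simp: bad_def)
  define g where "g = f(2*L := p, Suc (2*L) := q)"
  have gf: "g k = f k" if "k < 2*L" for k using that by (simp add: g_def)
  have dom: "{..<2 * Suc L} = insert (Suc (2*L)) (insert (2*L) {..<2*L})" by auto
  have gU: "g ` {..<2*L} = U" unfolding U_def by (rule image_cong) (auto simp: gf)
  have "inj_on g {..<2*L}" using f(1) gf by (metis inj_on_cong lessThan_iff)
  then have "inj_on g {..<2 * Suc L}"
    unfolding dom using gU p q by (auto simp: g_def)
  moreover have "g ` {..<2 * Suc L} \<subseteq> S" unfolding dom using gU U p q by (auto simp: g_def)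
  moreover have "\<forall>t<Suc L. R (g (2*t)) (g (Suc (2*t)))"
    using f(3) q by (auto simp: less_Suc_eq gf) (auto simp: g_def)
  ultimately show ?case by blast
qed

text \<open>Every sufficiently late block provides \<open>L\<close> disjoint pairs. It matters that
  \<open>\<delta>\<close> is fixed before \<open>L\<close> and \<open>Y\<close>: a large
  \<open>L\<close> later slows the decay from pair to pair, by an amount that depends on
  \<open>\<delta>\<close>.\<close>

lemma prime_pair_sequence:
  fixes b :: real
  obtains \<delta> where "\<delta> > 0" and
    "\<And>L Y. L > 0 \<Longrightarrow> \<exists>X q. X \<ge> Y \<and> X \<ge> 1 \<and> inj q \<and>
      (\<forall>k. prime (q k) \<and> X * 64 ^ (k div (2*L)) < real (q k) \<and> real (q k) \<le> X * 64 ^ Suc (k div (2*L))) \<and>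
      (\<forall>n. b = 0 \<or> \<bar>sin (b * ln (real (q (2*n)) / real (q (Suc (2*n)))))\<bar> \<ge> \<delta>)"
proof -
  obtain \<delta> where \<delta>: "\<delta> > 0" and ev: "\<forall>\<^sub>F x in at_top. \<forall>p\<in>primes_in x (64*x).
    real (card {q\<in>primes_in x (64*x). \<not> (b = 0 \<or> \<bar>sin (b * ln (real p / real q))\<bar> \<ge> \<delta>)}) \<le> (x / ln x) / 2"
  proof (cases "b = 0")
    case True
    have "\<forall>\<^sub>F x::real in at_top. 0 \<le> (x / ln x) / 2"
      by real_asymp
    \<comment> \<open>For \<open>b = 0\<close> nothing is demanded of the pairs, and 1 is an
      arbitrary positive value.\<close>
    then show ?thesis using True by (intro that[of 1]) (auto elim: eventually_mono)
  next
    case False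
    obtain \<delta> where "\<delta> > 0" "\<forall>\<^sub>F x in at_top. \<forall>p\<in>primes_in x (64*x).
        real (card {q\<in>primes_in x (64*x). \<bar>sin (b * ln (real p / real q))\<bar> < \<delta>}) \<le> (x / ln x) / 2"
      using eventually_few_aligned_primes[OF False] by blast
    then show ?thesis using that[of \<delta>] False by (simp add: not_le)
  qed
  show ?thesis
  proof (rule that[OF \<delta>])
    fix L :: nat and Y :: real assume L: "L > 0"
    let ?R = "\<lambda>p q. b = 0 \<or> \<bar>sin (b * ln (real p / real q))\<bar> \<ge> \<delta>"
    let ?f = "\<lambda>x (f::nat\<Rightarrow>nat). inj_on f {..<2*L} \<and> f ` {..<2*L} \<subseteq> primes_in x (64*x) \<and> (\<forall>t<L. ?R (f (2*t)) (f (Suc (2*t))))"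
    have "\<forall>\<^sub>F x::real in at_top. 4 * real L \<le> x / ln x" by real_asymp
    then have "\<forall>\<^sub>F x in at_top. \<exists>f. ?f x f"
      using ev eventually_card_primes_block
    proof eventually_elim
      case (elim x)
      have "2 * card {q\<in>primes_in x (64*x). \<not> ?R p q} \<le> card (primes_in x (64*x))" if "p \<in> primes_in x (64*x)" for p
      proof -
        have "real (card {q\<in>primes_in x (64*x). \<not> ?R p q}) \<le> (x / ln x) / 2" using elim(2) that by blast
        moreover have "2 * m \<le> n" if "real m \<le> z / 2" "z \<le> real n" for m n z using that by linarith
        ultimately show ?thesis using elim(3) by blast
      qed
      moreover have "4 * L \<le> card (primes_in x (64*x))" using elim(1,3) by linarith
      ultimately show ?case by (intro disjoint_pairs_exist) auto
    qed
    then obtain X0 where X0: "\<And>x. x \<ge> X0 \<Longrightarrow> \<exists>f. ?f x f" by (auto simp: eventually_at_top_linorder)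
    define X where "X = max 1 (max X0 Y)"
    have X: "X \<ge> X0" "X \<ge> Y" "X \<ge> 1" by (auto simp: X_def)
    have "\<exists>f. ?f (X * 64 ^ i) f" for i :: nat
    proof (rule X0)
      have "X * 1 \<le> X * 64 ^ i" using X by (intro mult_left_mono) auto
      then show "X0 \<le> X * 64 ^ i" using X by linarith
    qed
    then obtain F where F: "\<And>i. ?f (X * 64 ^ i) (F i)" by metis
    define q where "q k = F (k div (2*L)) (k mod (2*L))" for k
    have mem: "q k \<in> primes_in (X * 64 ^ (k div (2*L))) (X * 64 ^ Suc (k div (2*L)))" for k
    proof -
      have "k mod (2*L) \<in> {..<2*L}" using L by simp
      then have "q k \<in> primes_in (X * 64 ^ (k div (2*L))) (64 * (X * 64 ^ (k div (2*L))))"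
        using F[of "k div (2*L)"] unfolding q_def by blast
      then show ?thesis by (simp add: mult.left_commute)
    qed
    have le: "k div (2*L) \<le> j div (2*L)" if "q k = q j" for j k
    proof (rule ccontr)
      assume "\<not> k div (2*L) \<le> j div (2*L)"
      then have "X * 64 ^ Suc (j div (2*L)) \<le> X * 64 ^ (k div (2*L))"
        using X by (intro mult_left_mono power_increasing) auto
      also have "\<dots> < real (q k)" using mem[of k] by (simp add: primes_in_def)
      also have "\<dots> \<le> X * 64 ^ Suc (j div (2*L))" using mem[of j] that by (simp add: primes_in_def)
      finally show False by simp
    qed
    have "inj q"
    proof (rule injI)
      fix j k assume jk: "q j = q k"
      have d: "j div (2*L) = k div (2*L)" using le[OF jk] le[OF jk[symmetric]] by simp
      have "j mod (2*L) = k mod (2*L)"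
      proof (rule inj_onD)
        show "inj_on (F (k div (2*L))) {..<2*L}" using F by blast
        show "F (k div (2*L)) (j mod (2*L)) = F (k div (2*L)) (k mod (2*L))" using jk d by (simp add: q_def)
      qed (use L in auto)
      then show "j = k" using d by (metis div_mult_mod_eq)
    qed
    \<comment> \<open>The block length \<open>2*L\<close> is even, so the positions
      \<open>2*n\<close> and \<open>Suc (2*n)\<close> always fall into the same block and form one
      of its pairs.\<close>
    moreover have "?R (q (2*n)) (q (Suc (2*n)))" for n
    proof -
      have lt: "n mod L < L" using L by simp
      have "2*n mod (2*L) = 2 * (n mod L)" by (rule mult_mod_right[symmetric])
      moreover have "2*n div (2*L) = n div L" by simp
      moreover have "Suc (2*n) mod (2*L) = Suc (2 * (n mod L)) \<and> Suc (2*n) div (2*L) = n div L"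
      proof -
        have "Suc (2*n) = (n div L) * (2*L) + Suc (2 * (n mod L))"
          by (metis add_Suc_right div_mult_mod_eq distrib_left mult.commute mult.left_commute)
        moreover have "Suc (2 * (n mod L)) < 2*L" using lt by linarith
        moreover have "(a * d + r) mod d = r \<and> (a * d + r) div d = a" if "r < d" for a d r :: nat
          using that by simp
        ultimately show ?thesis by presburger
      qed
      ultimately have "q (2*n) = F (n div L) (2 * (n mod L))" "q (Suc (2*n)) = F (n div L) (Suc (2 * (n mod L)))"
        by (auto simp: q_def)
      then show ?thesis using F[of "n div L"] lt by metis
    qed
    ultimately show "\<exists>X q. X \<ge> Y \<and> X \<ge> 1 \<and> inj q \<and>
      (\<forall>k. prime (q k) \<and> X * 64 ^ (k div (2*L)) < real (q k) \<and> real (q k) \<le> X * 64 ^ Suc (k div (2*L))) \<and>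
      (\<forall>n. ?R (q (2*n)) (q (Suc (2*n))))"
      using X mem by (intro exI[of _ X] exI[of _ q]) (auto simp: primes_in_def)
  qed
qed

section \<open>Divisor functions\<close>

lemma nat_powr_eq_exp: "n > 0 \<Longrightarrow> of_nat n powr c = exp (c * complex_of_real (ln (real n)))"
  by (simp add: powr_def Ln_of_nat)

lemma nat_powr_mult:
  "m > 0 \<Longrightarrow> n > 0 \<Longrightarrow> of_nat (m * n) powr c = (of_nat m powr c * of_nat n powr c :: complex)"
  by (simp only: nat_powr_eq_exp nat_0_less_mult_iff simp_thms)
    (simp add: ln_mult distrib_left exp_add)

lemma nat_powr_power:
  assumes "n > 0"
  shows "of_nat (n ^ k) powr c = (of_nat n powr c :: complex) ^ k"
proof (induction k)
  case (Suc k)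
  show ?case using nat_powr_mult[of n "n ^ k" c] assms Suc.IH by simp
qed simp

lemma norm_nat_powr: "n > 0 \<Longrightarrow> norm (of_nat n powr c :: complex) = real n powr Re c"
  by (simp add: nat_powr_eq_exp powr_def)

text \<open>Coprimality makes the map from \<open>d\<close> to \<open>(gcd d m, gcd d n)\<close>
  inverse to the multiplication of divisors.\<close>

lemma divisor_sigma_mult_coprime:
  assumes "coprime m n" "m > 0" "n > 0"
  shows "divisor_sigma c (m * n) = divisor_sigma c m * divisor_sigma c n"
proof -
  have g: "gcd (d * e) m = d \<and> gcd (d * e) n = e" if "d dvd m" "e dvd n" for d e
  proof -
    have "coprime m e" "coprime n d"
      using that assms(1) by (auto simp: coprime_commute intro: coprime_divisors[of d m n n] coprime_divisors[of m m e n])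
    then show ?thesis
      using that by (simp add: gcd_mult_left_right_cancel gcd_mult_left_left_cancel gcd_nat.absorb1)
  qed
  have "divisor_sigma c m * divisor_sigma c n =
      (\<Sum>(d, e)\<in>{d. d dvd m} \<times> {e. e dvd n}. of_nat d powr c * of_nat e powr c)"
    unfolding divisor_sigma_def by (simp add: sum_product sum.cartesian_product)
  also have "\<dots> = (\<Sum>d | d dvd m * n. of_nat d powr c)"
  proof (rule sum.reindex_bij_witness[where j = "\<lambda>(d, e). d * e" and i = "\<lambda>d. (gcd d m, gcd d n)"])
    fix a assume "a \<in> {d. d dvd m} \<times> {e. e dvd n}"
    then obtain d e where a: "a = (d, e)" "d dvd m" "e dvd n" by auto
    show "(gcd (case a of (d, e) \<Rightarrow> d * e) m, gcd (case a of (d, e) \<Rightarrow> d * e) n) = a" using a g by simp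
    show "(case a of (d, e) \<Rightarrow> d * e) \<in> {d. d dvd m * n}" using a by (simp add: mult_dvd_mono)
    show "of_nat (case a of (d, e) \<Rightarrow> d * e) powr c = (case a of (d, e) \<Rightarrow> of_nat d powr c * of_nat e powr c)"
      using a assms nat_powr_mult[of d e c] by (simp add: dvd_pos_nat)
  next
    fix d assume "d \<in> {d. d dvd m * n}"
    then obtain d1 d2 where "d = d1 * d2" "d1 dvd m" "d2 dvd n" by (auto elim: dvd_productE)
    then show "(case (gcd d m, gcd d n) of (d, e) \<Rightarrow> d * e) = d" using g by simp
    show "(gcd d m, gcd d n) \<in> {d. d dvd m} \<times> {e. e dvd n}" by simp
  qed
  finally show ?thesis by (simp add: divisor_sigma_def)
qed

lemma divisor_sigma_prime_power:
  assumes "prime p"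
  shows "divisor_sigma c (p ^ k) = (\<Sum>i\<le>k. (of_nat p powr c) ^ i)"
proof -
  have "{d. d dvd p ^ k} = (\<lambda>i. p ^ i) ` {..k}"
    using assms by (auto simp: divides_primepow_nat)
  moreover have "inj_on (\<lambda>i. p ^ i) {..k}"
    using prime_gt_1_nat[OF assms] by (auto intro!: inj_onI)
  ultimately show ?thesis
    unfolding divisor_sigma_def using prime_gt_0_nat[OF assms]
    by (simp add: sum.reindex nat_powr_power del: of_nat_power)
qed

lemma divisor_sigma_1 [simp]: "divisor_sigma c (Suc 0) = 1"
  by (simp add: divisor_sigma_def)

section \<open>Components of a closure\<close>

text \<open>Components of a closed set are closed, so the finitely many through \<open>R\<close>
  form a closed set that contains \<open>S\<close>, hence its closure. It therefore suffices to join
  the values themselves, not their limits, to points of \<open>R\<close>.\<close>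

lemma finite_components_closure:
  fixes S :: "'a::euclidean_space set"
  assumes "finite R" and R: "\<And>x. x \<in> S \<Longrightarrow> \<exists>r\<in>R. connected_component (closure S) r x"
  shows "finite (components (closure S))"
proof -
  let ?C = "connected_component_set (closure S)"
  have "closed (\<Union>r\<in>R. ?C r)"
    using assms(1) closed_connected_component[OF closed_closure] by (intro closed_UN) auto
  moreover have "S \<subseteq> (\<Union>r\<in>R. ?C r)" using R by auto
  ultimately have cover: "closure S \<subseteq> (\<Union>r\<in>R. ?C r)" by (rule closure_minimal[rotated])
  have "components (closure S) \<subseteq> ?C ` R"
  proof
    fix K assume "K \<in> components (closure S)"
    then obtain x where x: "x \<in> closure S" "K = ?C x" by (auto simp: components_iff)
    then obtain r where r: "r \<in> R" "x \<in> ?C r" using cover by auto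
    then show "K \<in> ?C ` R" using connected_component_eq[OF r(2)] x(2) by simp
  qed
  then show ?thesis using assms(1) by (rule finite_surj[rotated])
qed

lemma connected_component_if_subset:
  "connected T \<Longrightarrow> T \<subseteq> S \<Longrightarrow> x \<in> T \<Longrightarrow> y \<in> T \<Longrightarrow> connected_component S x y"
  unfolding connected_component_def by blast

section \<open>Purely imaginary exponents\<close>

text \<open>A rational quotient of the two logarithms would give \<open>p ^ n = q ^ m\<close> with
  \<open>n \<noteq> 0\<close>, against unique factorization.\<close>

lemma two_primes_ln_not_both_rational:
  fixes b :: real
  assumes "b \<noteq> 0" "prime p" "prime q" "p \<noteq> q" "b * ln (real p) \<in> \<rat>" "b * ln (real q) \<in> \<rat>"
  shows False
proof -
  have pos: "ln (real p) > 0" "ln (real q) > 0"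
    using prime_gt_1_nat[OF assms(2)] prime_gt_1_nat[OF assms(3)] by auto
  have "(b * ln (real p)) / (b * ln (real q)) \<in> \<rat>" using assms by (intro Rats_divide)
  then have "ln (real p) / ln (real q) \<in> \<rat>" using assms(1) by simp
  then obtain m n :: nat where mn: "n \<noteq> 0" "\<bar>ln (real p) / ln (real q)\<bar> = real m / real n"
    by (rule Rats_abs_nat_div_natE)
  then have "real n * ln (real p) = real m * ln (real q)" using pos by (simp add: field_simps)
  then have "ln (real (p ^ n)) = ln (real (q ^ m))"
    using prime_gt_0_nat[OF assms(2)] prime_gt_0_nat[OF assms(3)] by (simp add: ln_realpow)
  then have "real (p ^ n) = real (q ^ m)"
    using prime_gt_0_nat[OF assms(2)] prime_gt_0_nat[OF assms(3)]
    by (subst (asm) ln_inj_iff) auto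
  then have "p ^ n = q ^ m" by (simp only: of_nat_eq_iff)
  then have "p dvd q ^ m" using mn(1) by (metis dvd_power gr0I)
  then show False using assms prime_dvd_power primes_dvd_imp_eq by blast
qed

text \<open>Kronecker's theorem in dimension one. Multiples start at \<open>Suc 0\<close> because
  the geometric sum up to \<open>z ^ k\<close> involves \<open>z ^ Suc k\<close>.\<close>

lemma irrational_frac_closure:
  fixes \<theta> :: real
  assumes "\<theta> \<notin> \<rat>"
  shows "{0..1} \<subseteq> closure ((\<lambda>k. frac (real (Suc k) * \<theta>)) ` UNIV)"
proof
  fix \<alpha> :: real assume \<alpha>: "\<alpha> \<in> {0..1}"
  show "\<alpha> \<in> closure ((\<lambda>k. frac (real (Suc k) * \<theta>)) ` UNIV)"
    unfolding closure_approachable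
  proof (intro allI impI)
    fix e :: real assume "e > 0"
    then obtain k where k: "k > 0" "\<bar>frac (real k * \<theta>) - \<alpha>\<bar> < e"
      using Kronecker_approx_1_explicit[of \<theta> \<alpha> e] assms \<alpha> by auto
    then have "dist (frac (real (Suc (k - 1)) * \<theta>)) \<alpha> < e" by (simp add: dist_real_def)
    then show "\<exists>y\<in>(\<lambda>k. frac (real (Suc k) * \<theta>)) ` UNIV. dist y \<alpha> < e" by blast
  qed
qed

lemma finite_components_imaginary:
  fixes c :: complex
  assumes "Re c = 0" "c \<noteq> 0"
  shows "finite (components (closure (divisor_sigma c ` {n. n > 0})))"
proof (rule finite_components_closure[of "{0}"])
  fix x assume "x \<in> divisor_sigma c ` {n. n > 0}"
  then obtain n where n: "n > 0" "x = divisor_sigma c n" by auto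
  define b where "b = Im c"
  have b: "b \<noteq> 0" "c = \<i> * of_real b" using assms by (auto simp: b_def complex_eq_iff)
  obtain p where p: "prime p" "p > n" using bigger_prime by blast
  obtain q where q: "prime q" "q > p" using bigger_prime by blast
  \<comment> \<open>Of two distinct primes exceeding \<open>n\<close>, at least one has an
    irrational rotation angle.\<close>
  have "\<exists>p. prime p \<and> p > n \<and> b / (2 * pi) * ln (real p) \<notin> \<rat>"
  proof (cases "b / (2 * pi) * ln (real p) \<in> \<rat>")
    case True
    have "b / (2 * pi) * ln (real q) \<notin> \<rat>"
      using two_primes_ln_not_both_rational[OF _ p(1) q(1) _ True] b(1) q(2) by auto
    then show ?thesis using p q by (intro exI[of _ q]) simp
  qed (use p in blast)
  then obtain p where p: "prime p" "p > n" and irr: "b / (2 * pi) * ln (real p) \<notin> \<rat>" by blast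
  define \<theta> where "\<theta> = b / (2 * pi) * ln (real p)"
  define z where "z = (of_nat p powr c :: complex)"
  have z: "z ^ k = cis (2 * pi * frac (real k * \<theta>))" for k
  proof -
    have "z = cis (2 * pi * \<theta>)"
      using prime_gt_0_nat[OF p(1)] unfolding z_def
      by (simp add: nat_powr_eq_exp b \<theta>_def cis_conv_exp mult.assoc)
    then have "z ^ k = cis (real k * (2 * pi * \<theta>))" by (simp only: Complex.DeMoivre)
    also have "real k * (2 * pi * \<theta>) = 2 * pi * frac (real k * \<theta>) + 2 * pi * of_int \<lfloor>real k * \<theta>\<rfloor>"
      by (simp add: frac_def algebra_simps)
    also have "cis \<dots> = cis (2 * pi * frac (real k * \<theta>))"
      by (simp add: cis_mult[symmetric] cis_multiple_2pi)
    finally show ?thesis .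
  qed
  have z1: "z \<noteq> 1"
  proof
    assume "z = 1"
    then have "cis (2 * pi * frac \<theta>) = 1" using z[of 1] by simp
    then have "cos (2 * pi * frac \<theta>) = 1" by (metis cis.sel(1) one_complex.sel(1))
    then obtain m :: int where m: "2 * pi * frac \<theta> = of_int m * (2 * pi)"
      by (auto simp: cos_one_2pi_int)
    then have "frac \<theta> = of_int m" by simp
    then have "\<theta> = of_int (m + \<lfloor>\<theta>\<rfloor>)" by (simp add: frac_def)
    then show False using irr unfolding \<theta>_def[symmetric] by (metis Rats_of_int)
  qed
  \<comment> \<open>The closed form of the geometric sum with \<open>z ^ Suc k\<close> replaced by
    an arbitrary point of the unit circle. At \<open>t = 0\<close> it vanishes, which puts 0 on the
    curve.\<close>
  define \<psi> where "\<psi> t = (1 - cis (2 * pi * t)) / (1 - z)" for t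
  have cont: "continuous_on UNIV \<psi>"
    unfolding \<psi>_def using z1 by (intro continuous_intros) auto
  have \<psi>: "\<psi> (frac (real (Suc k) * \<theta>)) = divisor_sigma c (p ^ k)" for k
    unfolding \<psi>_def z[symmetric] divisor_sigma_prime_power[OF p(1)] z_def[symmetric]
    using z1 by (simp add: sum_gp0)
  define T where "T = (\<lambda>t. x * \<psi> t) ` {0..1}"
  have contx: "continuous_on S (\<lambda>t. x * \<psi> t)" for S
    using cont by (intro continuous_intros) (rule continuous_on_subset, auto)
  have "connected T" unfolding T_def by (intro connected_continuous_image contx) simp
  moreover have "T \<subseteq> closure (divisor_sigma c ` {n. n > 0})"
  proof -
    have "T \<subseteq> (\<lambda>t. x * \<psi> t) ` closure ((\<lambda>k. frac (real (Suc k) * \<theta>)) ` UNIV)"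
      unfolding T_def using irr by (intro image_mono irrational_frac_closure) (simp only: \<theta>_def simp_thms)
    also have "\<dots> \<subseteq> closure ((\<lambda>t. x * \<psi> t) ` (\<lambda>k. frac (real (Suc k) * \<theta>)) ` UNIV)"
      by (intro image_closure_subset contx closure_subset) auto
    also have "\<dots> \<subseteq> closure (divisor_sigma c ` {n. n > 0})"
    proof (rule closure_mono, clarify)
      fix k
      have "coprime n (p ^ k)" using p n by (metis coprime_commute coprime_power_right_iff dvd_imp_le leD prime_imp_coprime)
      then have "divisor_sigma c (n * p ^ k) = x * \<psi> (frac (real (Suc k) * \<theta>))"
        unfolding \<psi> n(2) using n(1) prime_gt_0_nat[OF p(1)] by (intro divisor_sigma_mult_coprime) auto
      moreover have "n * p ^ k > 0" using n(1) prime_gt_0_nat[OF p(1)] by simp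
      ultimately show "x * \<psi> (frac (real (Suc k) * \<theta>)) \<in> divisor_sigma c ` {n. n > 0}" by (metis imageI mem_Collect_eq)
    qed
    finally show ?thesis .
  qed
  moreover have "0 \<in> T" unfolding T_def by (rule image_eqI[of _ _ 0]) (auto simp: \<psi>_def)
  moreover have "x \<in> T" unfolding T_def
    using \<psi>[of 0] by (intro image_eqI[of _ _ "frac \<theta>"]) (auto simp: frac_ge_0 frac_lt_1 less_imp_le)
  ultimately show "\<exists>r\<in>{0}. connected_component (closure (divisor_sigma c ` {n. n > 0})) r x"
    using connected_component_if_subset by blast
qed simp

section \<open>Negative real part: logarithms and directions\<close>

text \<open>The radius 1/4 makes the quadratic error at most half of \<open>norm w\<close>.\<close>

lemma Ln_one_plus_bounds:
  fixes w :: complex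
  assumes "norm w \<le> 1/4"
  shows "norm (Ln (1 + w) - w) \<le> 2 * (norm w)\<^sup>2" "norm w / 2 \<le> norm (Ln (1 + w))" "norm (Ln (1 + w)) \<le> 2 * norm w"
proof -
  have "norm (Ln (1 + w) - w) \<le> (norm w)\<^sup>2 / (1 - norm w)"
    using assms by (intro Ln_approx_linear) auto
  also have "\<dots> \<le> (norm w)\<^sup>2 / (1/2)" using assms by (intro divide_left_mono) auto
  finally show 1: "norm (Ln (1 + w) - w) \<le> 2 * (norm w)\<^sup>2" by simp
  have "2 * (norm w)\<^sup>2 \<le> norm w / 2"
    using mult_right_mono[OF assms, of "norm w"] by (simp add: power2_eq_square)
  then show "norm w / 2 \<le> norm (Ln (1 + w))" "norm (Ln (1 + w)) \<le> 2 * norm w"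
    using 1 norm_triangle_ineq3[of "Ln (1 + w)" w] norm_ge_zero[of w] by linarith+
qed

lemma inner_rcis: "inner (rcis r \<alpha>) (rcis s \<beta>) = r * s * cos (\<alpha> - \<beta>)"
  by (simp add: inner_complex_def rcis_def cos_diff algebra_simps)

text \<open>If \<phi> is nearly orthogonal to both \<alpha> and \<beta>, these two are nearly
  parallel. The bound is the addition theorem for the difference of \<open>\<phi> - \<beta>\<close>
  and \<open>\<phi> - \<alpha>\<close>.\<close>

lemma abs_sin_diff_le: "\<bar>sin (\<alpha> - \<beta>)\<bar> \<le> \<bar>cos (\<phi> - \<alpha>)\<bar> + \<bar>cos (\<phi> - \<beta>)\<bar>" for \<alpha> :: real
proof -
  have "sin (\<alpha> - \<beta>) = sin ((\<phi> - \<beta>) - (\<phi> - \<alpha>))" by simp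
  also have "\<dots> = sin (\<phi> - \<beta>) * cos (\<phi> - \<alpha>) - cos (\<phi> - \<beta>) * sin (\<phi> - \<alpha>)" by (rule sin_diff)
  also have "\<bar>\<dots>\<bar> \<le> \<bar>sin (\<phi> - \<beta>) * cos (\<phi> - \<alpha>)\<bar> + \<bar>cos (\<phi> - \<beta>) * sin (\<phi> - \<alpha>)\<bar>" by (rule abs_triangle_ineq4)
  also have "\<dots> \<le> 1 * \<bar>cos (\<phi> - \<alpha>)\<bar> + \<bar>cos (\<phi> - \<beta>)\<bar> * 1"
    unfolding abs_mult by (intro add_mono mult_right_mono mult_left_mono abs_sin_le_one) auto
  finally show ?thesis by simp
qed

lemma nat_powr_rcis: "n > 0 \<Longrightarrow> of_nat n powr c = rcis (real n powr Re c) (Im c * ln (real n))"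
  by (simp add: nat_powr_eq_exp exp_eq_polar powr_def rcis_def)

text \<open>The power of \<open>m\<close> has argument \<open>Im c * ln m\<close>; by
  \<open>abs_sin_diff_le\<close> the cosines of the angles between \<open>r\<close> and the two
  powers cannot both be below \<open>\<delta> / 2\<close> in absolute value.\<close>

lemma one_of_pair_not_orthogonal:
  fixes r c :: complex
  assumes "p > 0" "q > 0" and "\<bar>sin (Im c * ln (real p / real q))\<bar> \<ge> \<delta>"
  shows "\<exists>m\<in>{p,q}. \<delta> / 2 * norm r * norm (of_nat m powr c :: complex) \<le> \<bar>inner r (of_nat m powr c)\<bar>"
proof (rule ccontr)
  define \<phi> where "\<phi> = Arg r"
  have r: "r = rcis (norm r) \<phi>" by (simp add: \<phi>_def rcis_cmod_Arg)
  have in_eq: "\<bar>inner r (of_nat m powr c)\<bar> = (norm r * norm (of_nat m powr c :: complex)) * \<bar>cos (\<phi> - Im c * ln (real m))\<bar>"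
    if "m > 0" for m
    using that by (subst r) (simp add: nat_powr_rcis inner_rcis abs_mult)
  assume "\<not> ?thesis"
  then have "\<not> \<delta> / 2 * norm r * norm (of_nat p powr c :: complex) \<le> \<bar>inner r (of_nat p powr c)\<bar>"
    "\<not> \<delta> / 2 * norm r * norm (of_nat q powr c :: complex) \<le> \<bar>inner r (of_nat q powr c)\<bar>" by auto
  moreover have "\<delta> / 2 * norm r * norm (of_nat m powr c :: complex) \<le> \<bar>inner r (of_nat m powr c)\<bar>"
    if "m > 0" "\<delta> / 2 \<le> \<bar>cos (\<phi> - Im c * ln (real m))\<bar>" for m
  proof -
    have "(norm r * norm (of_nat m powr c :: complex)) * (\<delta> / 2) \<le> (norm r * norm (of_nat m powr c :: complex)) * \<bar>cos (\<phi> - Im c * ln (real m))\<bar>"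
      using that by (intro mult_left_mono) auto
    then show ?thesis using in_eq[OF that(1)] by (simp add: mult_ac)
  qed
  ultimately have "\<bar>cos (\<phi> - Im c * ln (real p))\<bar> < \<delta> / 2" "\<bar>cos (\<phi> - Im c * ln (real q))\<bar> < \<delta> / 2"
    using assms by (meson not_le)+
  moreover have "Im c * ln (real p / real q) = Im c * ln (real p) - Im c * ln (real q)"
    using assms by (simp add: ln_div algebra_simps)
  ultimately show False
    using abs_sin_diff_le[of "Im c * ln (real p)" "Im c * ln (real q)" \<phi>] assms(3) by simp
qed

text \<open>Replacing \<open>w\<close> by \<open>Ln (1 + w)\<close> in the inner product costs at
  most half of the lower bound, since \<open>norm w \<le> \<delta> / 8\<close>; comparing the norms
  costs another factor 2.\<close>

lemma inner_Ln_one_plus_ge: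
  fixes r w :: complex
  assumes "\<delta> / 2 * norm r * norm w \<le> \<bar>inner r w\<bar>" "norm w \<le> \<delta> / 8" "norm w \<le> 1/4" "\<delta> > 0"
  shows "\<delta> / 8 * norm r * norm (Ln (1 + w)) \<le> \<bar>inner r (Ln (1 + w))\<bar>"
proof -
  have "\<bar>inner r (Ln (1 + w) - w)\<bar> \<le> norm r * norm (Ln (1 + w) - w)" by (rule Cauchy_Schwarz_ineq2)
  also have "\<dots> \<le> norm r * (2 * (norm w)\<^sup>2)" using assms by (intro mult_left_mono Ln_one_plus_bounds) auto
  also have "\<dots> \<le> norm r * (\<delta> / 4 * norm w)"
    using mult_right_mono[OF assms(2), of "norm w"] by (intro mult_left_mono) (auto simp: power2_eq_square)
  finally have "\<bar>inner r (Ln (1 + w)) - inner r w\<bar> \<le> norm r * (\<delta> / 4 * norm w)" by (simp add: inner_diff_right)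
  moreover have "\<bar>inner r w\<bar> \<le> \<bar>inner r (Ln (1 + w))\<bar> + \<bar>inner r (Ln (1 + w)) - inner r w\<bar>" by linarith
  moreover have "\<delta> / 2 * norm r * norm w = 2 * (norm r * (\<delta> / 4 * norm w))" by simp
  moreover have "\<delta> / 4 * norm r * norm w = norm r * (\<delta> / 4 * norm w)" by simp
  ultimately have "\<delta> / 4 * norm r * norm w \<le> \<bar>inner r (Ln (1 + w))\<bar>" using assms(1) by linarith
  moreover have "\<delta> / 8 * norm r * norm (Ln (1 + w)) \<le> \<delta> / 8 * norm r * (2 * norm w)"
    using assms by (intro mult_left_mono Ln_one_plus_bounds) auto
  ultimately show ?thesis by simp
qed

text \<open>Injectivity makes the product squarefree. The factors are the exponentials of the
  logarithms whose subsums are studied.\<close>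

lemma divisor_sigma_prod_primes:
  assumes "finite A" "inj_on q A" "\<And>k. k \<in> A \<Longrightarrow> prime (q k)"
  shows "divisor_sigma c (\<Prod>k\<in>A. q k) = (\<Prod>k\<in>A. 1 + of_nat (q k) powr c)"
  using assms
proof (induction A rule: finite_induct)
  case (insert k A)
  have "coprime (q k) (\<Prod>k\<in>A. q k)"
  proof (rule prod_coprime_right)
    fix j assume "j \<in> A"
    then have "q k \<noteq> q j" using insert.prems(1) insert.hyps(2) by (auto simp: inj_on_def)
    then show "coprime (q k) (q j)" using insert.prems(2) \<open>j \<in> A\<close> by (intro primes_coprime) auto
  qed
  moreover have "q k > 0" "(\<Prod>k\<in>A. q k) > 0"
    using insert.prems(2) by (auto intro!: prod_pos simp: prime_gt_0_nat)
  ultimately have "divisor_sigma c (q k * (\<Prod>k\<in>A. q k)) = divisor_sigma c (q k) * divisor_sigma c (\<Prod>k\<in>A. q k)"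
    by (intro divisor_sigma_mult_coprime)
  moreover have "divisor_sigma c (q k) = 1 + of_nat (q k) powr c"
    using divisor_sigma_prime_power[of "q k" c 1] insert.prems by simp
  ultimately show ?case using insert by simp
qed simp

text \<open>Factoring out the power of \<open>p\<close> leaves a geometric sum bounded by 2,
  uniformly in \<open>k\<close>.\<close>

lemma norm_divisor_sigma_prime_power_diff_1:
  assumes "prime p" "norm (of_nat p powr c :: complex) \<le> 1/2"
  shows "norm (divisor_sigma c (p ^ k) - 1) \<le> 2 * norm (of_nat p powr c :: complex)"
proof -
  define z where "z = (of_nat p powr c :: complex)"
  have "divisor_sigma c (p ^ k) - 1 = (\<Sum>i\<le>k. z ^ i) - 1"
    using assms(1) by (simp add: divisor_sigma_prime_power z_def)
  also have "\<dots> = z * (\<Sum>i<k. z ^ i)"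
    by (cases k) (simp_all add: sum.atMost_Suc_shift lessThan_Suc_atMost sum_distrib_left del: sum.atMost_Suc)
  finally have eq: "divisor_sigma c (p ^ k) - 1 = z * (\<Sum>i<k. z ^ i)" .
  have "norm (\<Sum>i<k. z ^ i) \<le> (\<Sum>i<k. norm (z ^ i))" by (rule norm_sum)
  also have "\<dots> \<le> (\<Sum>i<k. (1/2) ^ i)"
    unfolding norm_power using assms(2) by (intro sum_mono power_mono) (auto simp: z_def)
  also have "\<dots> \<le> 2" by (simp add: sum_gp_strict)
  finally show ?thesis unfolding eq norm_mult z_def[symmetric] by (metis mult.commute mult_left_mono norm_ge_zero)
qed

text \<open>For real exponents, quotients of values are positive, so their logarithms stay on the
  real line, to which the subsum argument is then restricted.\<close>

lemma divisor_sigma_real_pos: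
  assumes "Im c = 0" "n > 0"
  shows "divisor_sigma c n \<in> \<real>" "Re (divisor_sigma c n) > 0"
proof -
  have c: "c = of_real (Re c)" using assms by (simp add: complex_eq_iff)
  have eq: "divisor_sigma c n = of_real (\<Sum>d | d dvd n. exp (Re c * ln (real d)))"
    unfolding divisor_sigma_exp[OF assms(2)] by (subst c) (simp flip: exp_of_real)
  show "divisor_sigma c n \<in> \<real>" unfolding eq by (rule Reals_of_real)
  have "(\<Sum>d | d dvd n. exp (Re c * ln (real d))) > 0"
    using assms(2) by (intro sum_pos) auto
  then show "Re (divisor_sigma c n) > 0" unfolding eq by simp
qed

text \<open>
  \<^term>\<open>F i\<close> is a connected set of limits of values at products of primes exceeding \<^term>\<open>X * 64 ^ i\<close>.
\<close>

lemma connected_rough_sets: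
  fixes c :: complex
  assumes "Re c < 0"
  obtains X h \<rho> :: real and F :: "nat \<Rightarrow> complex set" where "X \<ge> 1" "\<rho> > 0"
    "\<And>i. connected (F i)" "\<And>i. 1 \<in> F i"
    "\<And>i n. n > 0 \<Longrightarrow> (\<And>p. prime p \<Longrightarrow> p dvd n \<Longrightarrow> real p \<le> X * 64 ^ i) \<Longrightarrow>
      (*) (divisor_sigma c n) ` F i \<subseteq> closure (divisor_sigma c ` {n. n > 0})"
    "\<And>i w. w \<noteq> 0 \<Longrightarrow> (Im c = 0 \<Longrightarrow> w \<in> \<real> \<and> Re w > 0) \<Longrightarrow> norm (w - 1) \<le> \<rho> * h ^ i \<Longrightarrow>
      (*) w ` F i \<inter> F i \<noteq> {}"
    "\<And>i p k. prime p \<Longrightarrow> X * 64 ^ i < real p \<Longrightarrow> norm (divisor_sigma c (p ^ k) - 1) \<le> \<rho> * h ^ Suc i"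
proof -
  obtain \<delta> where \<delta>: "\<delta> > 0" and seq: "\<And>L Y. L > 0 \<Longrightarrow> \<exists>X q. X \<ge> Y \<and> X \<ge> 1 \<and> inj q \<and>
      (\<forall>k. prime (q k) \<and> X * 64 ^ (k div (2*L)) < real (q k) \<and> real (q k) \<le> X * 64 ^ Suc (k div (2*L))) \<and>
      (\<forall>n. Im c = 0 \<or> \<bar>sin (Im c * ln (real (q (2*n)) / real (q (Suc (2*n)))))\<bar> \<ge> \<delta>)"
    by (rule prime_pair_sequence[of "Im c"]) blast
  \<comment> \<open>The decay of the terms from one block to the next; its root of order
    \<open>L\<close>, called \<theta> below, is the average decay per pair.\<close>
  define h where "h = 64 powr Re c"
  have h: "0 < h" "h < 1" using assms powr_less_mono[of "Re c" 0 64] by (auto simp: h_def)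
  \<comment> \<open>The value \<open>\<delta>/8\<close> is the alignment that
    \<open>inner_Ln_one_plus_ge\<close> leaves.\<close>
  define \<kappa> where "\<kappa> = min (1/2) (\<delta>/8)"
  have \<kappa>: "0 < \<kappa>" "\<kappa> \<le> 1/2" "\<kappa> \<le> \<delta>/8" using \<delta> by (auto simp: \<kappa>_def)
  \<comment> \<open>Since \<theta> tends to 1 as \<open>L\<close> grows, some \<open>L\<close> gives
    both \<open>\<theta> > 1/2\<close>, needed for \<open>upper\<close>, and
    \<open>1 - \<theta>\<close> so small that \<open>lower\<close> holds.\<close>
  have "(\<lambda>L. 64 powr (Re c / real L)) \<longlonglongrightarrow> 64 powr 0"
    by (intro tendsto_powr tendsto_const lim_const_over_n) auto
  then have "\<forall>\<^sub>F L in sequentially. max (1/2) (1 - \<kappa>\<^sup>2 * h\<^sup>2 / 16) < 64 powr (Re c / real L)"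
    using h \<kappa> by (intro order_tendstoD(1)) auto
  then have "\<forall>\<^sub>F L in sequentially. L > 0 \<and> max (1/2) (1 - \<kappa>\<^sup>2 * h\<^sup>2 / 16) < 64 powr (Re c / real L)"
    using eventually_gt_at_top[of "0::nat"] by (rule eventually_conj[rotated])
  then obtain L where L: "L > 0" and L1: "max (1/2) (1 - \<kappa>\<^sup>2 * h\<^sup>2 / 16) < 64 powr (Re c / real L)"
    using eventually_happens[of _ sequentially] by (metis (no_types, lifting) sequentially_bot)
  define \<theta> where "\<theta> = 64 powr (Re c / real L)"
  have \<theta>: "1/2 < \<theta>" "1 - \<kappa>\<^sup>2 * h\<^sup>2 / 16 < \<theta>" using L1 by (auto simp: \<theta>_def)
  have \<theta>L: "\<theta> ^ L = h" unfolding \<theta>_def h_def using L by (simp add: powr_power)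
  have \<theta>1: "\<theta> < 1" using assms L powr_less_mono[of "Re c / real L" 0 64] by (simp add: \<theta>_def divide_neg_pos)
  have "((\<lambda>X. X powr Re c) \<longlongrightarrow> 0) at_top" using assms by (intro tendsto_neg_powr filterlim_ident)
  then have "\<forall>\<^sub>F X in at_top. X powr Re c < h * min (1/8) (\<delta>/8)"
    using \<delta> h by (intro order_tendstoD(2)) auto
  then obtain X0 where X0: "\<And>X. X \<ge> X0 \<Longrightarrow> X powr Re c < h * min (1/8) (\<delta>/8)"
    by (auto simp: eventually_at_top_linorder)
  obtain X q where X: "X \<ge> X0" "X \<ge> 1" and q: "inj q"
    "\<And>k. prime (q k) \<and> X * 64 ^ (k div (2*L)) < real (q k) \<and> real (q k) \<le> X * 64 ^ Suc (k div (2*L))"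
    and sin: "\<And>n. Im c = 0 \<or> \<bar>sin (Im c * ln (real (q (2*n)) / real (q (Suc (2*n)))))\<bar> \<ge> \<delta>"
    using seq[OF L, of X0] by blast
  define Y where "Y = X powr Re c"
  have Y: "0 < Y" "Y < h * min (1/8) (\<delta>/8)" using X0[OF X(1)] X(2) by (auto simp: Y_def)
  have Yh: "Y / h < 1/8" "Y / h < \<delta>/8"
  proof -
    have "Y / h < min (1/8) (\<delta>/8)" using Y(2) h(1) by (simp only: pos_divide_less_eq mult.commute)
    then show "Y / h < 1/8" "Y / h < \<delta>/8" by auto
  qed
  have Yle: "Y \<le> Y / h" using Y h by (simp add: field_simps)
  have block: "(X * 64 ^ i) powr Re c = Y * h ^ i" for i :: nat
    using X by (simp add: powr_mult Y_def h_def powr_power powr_powr mult.commute flip: powr_realpow)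
  have hi1: "h ^ i \<le> 1" for i using h by (simp add: power_le_one)
  have zp: "norm (of_nat p powr c :: complex) \<le> Y * h ^ i" if "X * 64 ^ i < real p" for p i
  proof -
    have "0 < X * 64 ^ i" using X by simp
    then have "real p powr Re c \<le> (X * 64 ^ i) powr Re c" using that assms by (intro powr_mono2') auto
    then show ?thesis using that \<open>0 < X * 64 ^ i\<close> by (simp add: norm_nat_powr block)
  qed
  have zp': "Y * h ^ i \<le> norm (of_nat p powr c :: complex)" if "p > 0" "real p \<le> X * 64 ^ i" for p i
    using powr_mono2'[of "Re c" "real p" "X * 64 ^ i"] that assms by (simp add: norm_nat_powr block)
  have Yhi: "Y * h ^ i \<le> Y" for i using Y hi1[of i] by simp
  define z where "z k = (of_nat (q k) powr c :: complex)" for k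
  define v where "v k = Ln (1 + z k)" for k
  have z_upper: "norm (z k) \<le> Y * h ^ (k div (2*L))" for k using zp q(2) by (auto simp: z_def)
  have z_small: "norm (z k) \<le> 1/4" "norm (z k) \<le> \<delta>/8" for k
    using z_upper[of k] Yhi[of "k div (2*L)"] Yle Yh by linarith+
  have z_lower: "Y * h ^ Suc (k div (2*L)) \<le> norm (z k)" for k
    unfolding z_def using q(2) prime_gt_0_nat by (intro zp') auto
  have div_eq: "k div (2*L) = (k div 2) div L" for k by (simp add: div_mult2_eq)
  \<comment> \<open>Within block \<open>i\<close> the powers of \<theta> stay between
    \<open>h ^ Suc i\<close> and \<open>h ^ i\<close>, so they match the sizes of the terms up to a
    factor \<open>h\<close>.\<close>
  have \<theta>_upper: "\<theta> ^ (k div 2) \<le> h ^ (k div (2*L))" for k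
  proof -
    have "\<theta> ^ (k div 2) \<le> \<theta> ^ (L * (k div 2 div L))" using \<theta> \<theta>1 by (intro power_decreasing) auto
    then show ?thesis by (simp add: power_mult \<theta>L div_eq)
  qed
  have \<theta>_lower: "h ^ Suc (k div (2*L)) \<le> \<theta> ^ (k div 2)" for k
  proof -
    have "k div 2 \<le> L * Suc (k div 2 div L)"
      using L by (metis dividend_less_times_div less_imp_le mult_Suc_right add.commute)
    then have "\<theta> ^ (L * Suc (k div 2 div L)) \<le> \<theta> ^ (k div 2)" using \<theta> \<theta>1 by (intro power_decreasing) auto
    then show ?thesis by (simp only: power_mult \<theta>L div_eq)
  qed
  \<comment> \<open>Then \<open>upper\<close> asks for
    \<open>4 * (Y / h) * \<theta> ^ Suc (k div 2)\<close>, which follows from the size of the terms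
    and \<open>2 * \<theta> > 1\<close>. Also \<open>M \<ge> 4 * Y / h\<close>, so logarithms of
    ratios within \<open>\<rho> * h ^ i\<close> of 1 are admissible shifts.\<close>
  define M where "M = 4 * Y / (h * \<kappa>)"
  have M: "M > 0" using Y h \<kappa> by (simp add: M_def)
  define V :: "complex set" where "V = (if Im c = 0 then \<real> else UNIV)"
  have zReal: "z k \<in> \<real> \<and> Re (1 + z k) > 0" if "Im c = 0" for k
  proof -
    have "z k = divisor_sigma c (q k) - 1"
      using divisor_sigma_prime_power[of "q k" c 1] q(2) by (simp add: z_def)
    then show ?thesis
      using divisor_sigma_real_pos[OF that, of "q k"] q(2) prime_gt_0_nat[of "q k"] by (auto intro: Reals_diff)
  qed
  have LnReal: "Ln w \<in> \<real>" if "w \<in> \<real>" "Re w > 0" for w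
    using that by (auto simp: Ln_of_real elim!: Reals_cases)
  interpret S: subsum_sequence v V \<theta> \<kappa> M
  proof
    show "subspace V" by (auto simp: V_def subspace_def Reals_add scaleR_conv_of_real intro: Reals_mult)
    show "v k \<in> V" for k using zReal[of k] by (auto simp: V_def v_def intro!: LnReal Reals_add)
    show "0 < \<theta>" "\<theta> < 1" using \<theta> \<theta>1 by auto
    show "0 < \<kappa>" "\<kappa> \<le> 1/2" using \<kappa> by auto
    show "0 < M" by (rule M)
    show "norm (v k) \<le> \<kappa> * M * \<theta> ^ Suc (k div 2)" for k
    proof -
      have "norm (v k) \<le> 2 * norm (z k)" unfolding v_def by (rule Ln_one_plus_bounds[OF z_small(1)])
      also have "\<dots> \<le> 2 * (Y / h) * h ^ Suc (k div (2*L))" using z_upper[of k] h by simp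
      also have "\<dots> \<le> 2 * (Y / h) * \<theta> ^ (k div 2)"
        using \<theta>_lower[of k] Y h by (intro mult_left_mono) auto
      also have "\<dots> \<le> 2 * (Y / h) * (2 * \<theta> * \<theta> ^ (k div 2))"
        using Y h \<theta> by (intro mult_left_mono) auto
      also have "\<dots> = \<kappa> * M * \<theta> ^ Suc (k div 2)" using \<kappa> h by (simp add: M_def field_simps)
      finally show ?thesis .
    qed
    show "2 * M * (1 - \<theta>) * \<theta> ^ (k div 2) \<le> \<kappa> * norm (v k)" for k
    proof -
      have "2 * M * (1 - \<theta>) * \<theta> ^ (k div 2) \<le> 2 * M * (\<kappa>\<^sup>2 * h\<^sup>2 / 16) * h ^ (k div (2*L))"
        using M \<theta> \<theta>1 \<theta>_upper[of k] h by (intro mult_mono) auto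
      also have "\<dots> = \<kappa> * ((Y * h ^ Suc (k div (2*L))) / 2)"
        using \<kappa> h by (simp add: M_def field_simps power2_eq_square)
      also have "\<dots> \<le> \<kappa> * (norm (z k) / 2)" using \<kappa> z_lower[of k] by (intro mult_left_mono) auto
      also have "\<dots> \<le> \<kappa> * norm (v k)"
        unfolding v_def using \<kappa> by (intro mult_left_mono Ln_one_plus_bounds z_small) auto
      finally show ?thesis .
    qed
    show "\<exists>k\<in>{2*n, Suc (2*n)}. \<kappa> * norm r * norm (v k) \<le> \<bar>r \<bullet> v k\<bar>" if "r \<in> V" for r n
    proof (cases "Im c = 0")
      case True
      have "r \<in> \<real>" "v (2*n) \<in> \<real>"
        using that True zReal[of "2*n"] by (auto simp: V_def v_def intro!: LnReal Reals_add)
      then have "norm r * norm (v (2*n)) = \<bar>r \<bullet> v (2*n)\<bar>"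
        by (auto elim!: Reals_cases simp: inner_complex_def abs_mult)
      moreover have "\<kappa> * (norm r * norm (v (2*n))) \<le> 1 * (norm r * norm (v (2*n)))"
        using \<kappa> by (intro mult_right_mono) auto
      ultimately show ?thesis by (auto simp: mult.assoc)
    next
      case False
      then obtain m where m: "m \<in> {q (2*n), q (Suc (2*n))}"
        "\<delta> / 2 * norm r * norm (of_nat m powr c :: complex) \<le> \<bar>inner r (of_nat m powr c)\<bar>"
        using one_of_pair_not_orthogonal[of "q (2*n)" "q (Suc (2*n))" \<delta> c r] sin[of n] q(2) prime_gt_0_nat by auto
      then obtain k where k: "k \<in> {2*n, Suc (2*n)}" "m = q k" by auto
      have "\<delta> / 8 * norm r * norm (v k) \<le> \<bar>r \<bullet> v k\<bar>"
        unfolding v_def using m(2) k(2) z_small[of k] \<delta> by (intro inner_Ln_one_plus_ge) (auto simp: z_def)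
      moreover have "\<kappa> * (norm r * norm (v k)) \<le> \<delta> / 8 * (norm r * norm (v k))"
        using \<kappa> by (intro mult_right_mono) auto
      ultimately have "\<kappa> * norm r * norm (v k) \<le> \<bar>r \<bullet> v k\<bar>" by (simp add: mult.assoc)
      then show ?thesis using k(1) by blast
    qed
  qed
  \<comment> \<open>The first \<open>L * i\<close> pairs fill the blocks before \<open>i\<close>, so
    only primes exceeding \<open>X * 64 ^ i\<close> enter.\<close>
  define F where "F i = exp ` S.subsums (L * i)" for i
  \<comment> \<open>With this value a power of a prime beyond \<open>X * 64 ^ i\<close> changes
    values by a factor within \<open>\<rho> * h ^ Suc i\<close> of 1, the tolerance of the next set
    \<open>F (Suc i)\<close>.\<close>
  define \<rho> where "\<rho> = 2 * (Y / h)"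
  show ?thesis
  proof (rule that[of X \<rho> F h])
    show "X \<ge> 1" by (rule X)
    show "\<rho> > 0" using Y h by (simp add: \<rho>_def)
    show "connected (F i)" for i
      unfolding F_def by (intro connected_continuous_image S.connected_subsums continuous_intros)
    show "1 \<in> F i" for i
      unfolding F_def using S.zero_in_subsums by (metis exp_zero imageI)
    show "(*) (divisor_sigma c n) ` F i \<subseteq> closure (divisor_sigma c ` {n. n > 0})"
      if n: "n > 0" "\<And>p. prime p \<Longrightarrow> p dvd n \<Longrightarrow> real p \<le> X * 64 ^ i" for i n
    proof -
      have "(*) (divisor_sigma c n) ` F i = (\<lambda>s. divisor_sigma c n * exp s) ` S.subsums (L * i)"
        by (simp add: F_def image_image)
      also have "\<dots> \<subseteq> closure ((\<lambda>s. divisor_sigma c n * exp s) ` {sum v A | A. finite A \<and> A \<subseteq> {2*(L*i)..}})"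
        unfolding S.subsums_def by (intro image_closure_subset closure_subset closed_closure continuous_intros)
      also have "\<dots> \<subseteq> closure (divisor_sigma c ` {n. n > 0})"
      proof (rule closure_mono, clarify)
        fix A assume A: "finite A" "A \<subseteq> {2*(L*i)..}"
        define m where "m = (\<Prod>k\<in>A. q k)"
        have m0: "m > 0" unfolding m_def using q(2) prime_gt_0_nat by (intro prod_pos) auto
        have "exp (sum v A) = (\<Prod>k\<in>A. exp (v k))" using A by (simp add: exp_sum)
        also have "\<dots> = (\<Prod>k\<in>A. 1 + z k)"
        proof (rule prod.cong)
          fix k
          have "norm (z k) < 1" using z_small(1)[of k] by simp
          then have "1 + z k \<noteq> 0" by (metis add_eq_0_iff2 less_irrefl norm_minus_cancel norm_one)
          then show "exp (v k) = 1 + z k" by (simp add: v_def)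
        qed simp
        also have "\<dots> = divisor_sigma c m"
          unfolding m_def z_def using A q by (intro divisor_sigma_prod_primes[symmetric]) (auto intro: inj_on_subset)
        finally have "exp (sum v A) = divisor_sigma c m" .
        moreover have "coprime n m" unfolding m_def
        proof (rule prod_coprime_right)
          fix k assume "k \<in> A"
          then have "L * i * 2 \<le> k" using A by auto
          then have "i \<le> k div (2*L)" using L by (simp add: less_eq_div_iff_mult_less_eq mult_ac)
          then have "X * 64 ^ i \<le> X * 64 ^ (k div (2*L))" using X by (intro mult_left_mono power_increasing) auto
          then have "\<not> q k dvd n" using n(2)[of "q k"] q(2)[of k] by force
          then show "coprime n (q k)" using q(2)[of k] prime_imp_coprime[of "q k" n] by (simp add: coprime_commute)
        qed
        ultimately have "divisor_sigma c n * exp (sum v A) = divisor_sigma c (n * m)"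
          using n(1) m0 by (simp add: divisor_sigma_mult_coprime)
        then show "divisor_sigma c n * exp (sum v A) \<in> divisor_sigma c ` {n. n > 0}" using n(1) m0 by auto
      qed
      finally show ?thesis .
    qed
    show "(*) w ` F i \<inter> F i \<noteq> {}"
      if w: "w \<noteq> 0" "Im c = 0 \<Longrightarrow> w \<in> \<real> \<and> Re w > 0" "norm (w - 1) \<le> \<rho> * h ^ i" for i w
    proof -
      have "\<rho> * h ^ i \<le> \<rho>" using hi1[of i] Y h by (intro mult_left_le) (auto simp: \<rho>_def)
      also have "\<rho> \<le> 1/4" unfolding \<rho>_def using Yh(1) by linarith
      finally have "norm (Ln (1 + (w - 1))) \<le> 2 * norm (w - 1)"
        using w(3) by (intro Ln_one_plus_bounds) linarith
      then have "norm (Ln w) \<le> 2 * (\<rho> * h ^ i)" using w(3) by simp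
      also have "\<dots> = 4 * (Y / h) * h ^ i" by (simp add: \<rho>_def)
      also have "\<dots> \<le> M * h ^ i"
        using h \<kappa> Y by (intro mult_right_mono) (auto simp: M_def field_simps)
      also have "\<dots> = M * \<theta> ^ (L * i)" by (simp add: power_mult \<theta>L)
      finally have "norm (Ln w) \<le> M * \<theta> ^ (L * i)" .
      moreover have "Ln w \<in> V" using w(2) LnReal by (auto simp: V_def)
      ultimately obtain x y where xy: "x \<in> S.subsums (L*i)" "y \<in> S.subsums (L*i)" "Ln w + x = y"
        using S.translate_meets_subsums by blast
      then have "w * exp x = exp y" using w(1) by (metis exp_Ln exp_add)
      then show ?thesis using xy unfolding F_def by blast
    qed
    show "norm (divisor_sigma c (p ^ k) - 1) \<le> \<rho> * h ^ Suc i" if "prime p" "X * 64 ^ i < real p" for i p k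
    proof -
      have z: "norm (of_nat p powr c :: complex) \<le> Y * h ^ i" by (rule zp[OF that(2)])
      then have "norm (of_nat p powr c :: complex) \<le> 1/2" using Yhi[of i] Yle Yh by linarith
      then have "norm (divisor_sigma c (p ^ k) - 1) \<le> 2 * norm (of_nat p powr c :: complex)"
        by (rule norm_divisor_sigma_prime_power_diff_1[OF that(1)])
      also have "\<dots> \<le> \<rho> * h ^ Suc i" using z h by (simp add: \<rho>_def)
      finally show ?thesis .
    qed
  qed
qed

section \<open>Values at integers with few prime factors\<close>

text \<open>In the closed form of the geometric sum, numerator and denominator both have norm
  between \<open>1 - \<beta>\<close> and 2.\<close>

lemma norm_divisor_sigma_prime_power_bounds:
  assumes "prime p" "norm (of_nat p powr c :: complex) \<le> \<beta>" "\<beta> < 1"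
  shows "norm (divisor_sigma c (p ^ k)) \<le> 2 / (1 - \<beta>)" "(1 - \<beta>) / 2 \<le> norm (divisor_sigma c (p ^ k))"
proof -
  define z where "z = (of_nat p powr c :: complex)"
  have z: "norm z \<le> \<beta>" "norm z < 1" using assms by (auto simp: z_def)
  have "z \<noteq> 1" using z by auto
  then have eq: "norm (divisor_sigma c (p ^ k)) = norm (1 - z ^ Suc k) / norm (1 - z)"
    using assms(1) by (simp add: divisor_sigma_prime_power sum_gp0 norm_divide flip: z_def)
  have "norm (z ^ Suc k) = norm z * norm z ^ k" by (simp add: norm_mult norm_power)
  also have "\<dots> \<le> norm z * 1" using z by (intro mult_left_mono power_le_one) auto
  finally have "norm (z ^ Suc k) \<le> \<beta>" using z by simp
  then have num: "1 - \<beta> \<le> norm (1 - z ^ Suc k)" "norm (1 - z ^ Suc k) \<le> 2"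
    using norm_triangle_ineq2[of 1 "z ^ Suc k"] norm_triangle_ineq4[of 1 "z ^ Suc k"] assms(3) by auto
  have den: "1 - \<beta> \<le> norm (1 - z)" "norm (1 - z) \<le> 2"
    using norm_triangle_ineq2[of 1 z] norm_triangle_ineq4[of 1 z] z by auto
  show "norm (divisor_sigma c (p ^ k)) \<le> 2 / (1 - \<beta>)"
    unfolding eq using num den assms(3) by (intro frac_le) auto
  show "(1 - \<beta>) / 2 \<le> norm (divisor_sigma c (p ^ k))"
    unfolding eq using num den assms(3) by (intro frac_le) auto
qed

lemma split_off_prime_power:
  fixes n :: nat
  assumes "n > 0" "prime p"
  obtains m k where "n = m * p ^ k" "coprime m (p ^ k)" "m > 0" "\<not> p dvd m"
proof -
  obtain m where m: "n = p ^ multiplicity p n * m" "\<not> p dvd m"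
    using multiplicity_decompose'[of n p] assms by (metis neq0_conv not_prime_unit)
  have "coprime m (p ^ multiplicity p n)"
    using assms(2) m(2) by (metis coprime_commute coprime_power_right_iff prime_imp_coprime)
  then show ?thesis using that[of m "multiplicity p n"] m assms(1) by (auto simp: mult.commute)
qed

text \<open>All primes satisfy the prime power bounds with \<open>\<beta> = 2 powr Re c\<close>, so
  each element of \<open>P\<close> costs at most the same factor \<open>A\<close>, whatever its
  exponent in \<open>n\<close>.\<close>

lemma norm_divisor_sigma_smooth_bounds:
  assumes "Re c < 0" "finite P"
  obtains B where "B \<ge> 1" "\<And>n. n > 0 \<Longrightarrow> (\<And>p. prime p \<Longrightarrow> p dvd n \<Longrightarrow> p \<in> P) \<Longrightarrow>
      norm (divisor_sigma c n) \<le> B \<and> 1 / B \<le> norm (divisor_sigma c n)"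
proof -
  define \<beta> where "\<beta> = (2::real) powr Re c"
  have \<beta>: "0 < \<beta>" "\<beta> < 1" using assms powr_less_mono[of "Re c" 0 2] by (auto simp: \<beta>_def)
  define A where "A = 2 / (1 - \<beta>)"
  have A: "A \<ge> 1" unfolding A_def using \<beta> by (simp add: field_simps)
  have zp: "norm (of_nat p powr c :: complex) \<le> \<beta>" if "prime p" for p
    using that assms prime_ge_2_nat[OF that] powr_mono2'[of "Re c" 2 "real p"]
    by (simp add: norm_nat_powr prime_gt_0_nat \<beta>_def)
  have "\<forall>n>0. (\<forall>p. prime p \<longrightarrow> p dvd n \<longrightarrow> p \<in> P) \<longrightarrow>
      norm (divisor_sigma c n) \<le> A ^ card P \<and> 1 / A ^ card P \<le> norm (divisor_sigma c n)"
    using assms(2)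
  proof (induction P rule: finite_induct)
    case empty
    show ?case
    proof (intro allI impI)
      fix n :: nat assume "\<forall>p. prime p \<longrightarrow> p dvd n \<longrightarrow> p \<in> {}"
      then have "n = 1" using prime_factor_nat by blast
      then show "norm (divisor_sigma c n) \<le> A ^ card {} \<and> 1 / A ^ card {} \<le> norm (divisor_sigma c n)" by simp
    qed
  next
    case (insert p P)
    show ?case
    proof (intro allI impI)
      fix n :: nat assume n: "n > 0" "\<forall>r. prime r \<longrightarrow> r dvd n \<longrightarrow> r \<in> insert p P"
      show "norm (divisor_sigma c n) \<le> A ^ card (insert p P) \<and> 1 / A ^ card (insert p P) \<le> norm (divisor_sigma c n)"
      proof (cases "prime p")
        \<comment> \<open>Members of \<open>P\<close> that are not prime merely raise the exponent
          of \<open>A\<close>.\<close>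
        case False
        then have "\<forall>r. prime r \<longrightarrow> r dvd n \<longrightarrow> r \<in> P" using n(2) by auto
        then have IH: "norm (divisor_sigma c n) \<le> A ^ card P" "1 / A ^ card P \<le> norm (divisor_sigma c n)"
          using insert.IH n(1) by auto
        have "A ^ card P \<le> A ^ card (insert p P)" using A insert.hyps by (intro power_increasing) auto
        then show ?thesis using IH A frac_le[of 1 1 "A ^ card P" "A ^ card (insert p P)"] by auto
      next
        case True
        obtain m k where m: "n = m * p ^ k" "coprime m (p ^ k)" "m > 0" "\<not> p dvd m"
          by (rule split_off_prime_power[OF n(1) True])
        have "\<forall>r. prime r \<longrightarrow> r dvd m \<longrightarrow> r \<in> P" using n(2) m by auto
        then have IH: "norm (divisor_sigma c m) \<le> A ^ card P" "1 / A ^ card P \<le> norm (divisor_sigma c m)"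
          using insert.IH m(3) by auto
        have pk: "norm (divisor_sigma c (p ^ k)) \<le> A" "1 / A \<le> norm (divisor_sigma c (p ^ k))"
          using norm_divisor_sigma_prime_power_bounds[OF True zp[OF True] \<beta>(2)] by (auto simp: A_def)
        have eq: "norm (divisor_sigma c n) = norm (divisor_sigma c m) * norm (divisor_sigma c (p ^ k))"
          unfolding m(1) using divisor_sigma_mult_coprime[OF m(2,3)] True by (simp add: prime_gt_0_nat norm_mult)
        have "norm (divisor_sigma c n) \<le> A ^ card P * A"
          unfolding eq using IH pk A by (intro mult_mono) auto
        moreover have "1 / A ^ card P * (1 / A) \<le> norm (divisor_sigma c n)"
          unfolding eq using IH pk A by (intro mult_mono) auto
        ultimately show ?thesis using insert.hyps by (simp add: mult.commute)
      qed
    qed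
  qed
  moreover have "A ^ card P \<ge> 1" using A by (rule one_le_power)
  ultimately show ?thesis using that by blast
qed

text \<open>Total boundedness, with centres in \<open>G\<close> itself, so that the representatives
  will be values at smooth integers.\<close>

lemma bounded_finite_net:
  fixes G :: "'a::euclidean_space set"
  assumes "bounded G" "e > 0"
  obtains R where "finite R" "R \<subseteq> G" "\<And>g. g \<in> G \<Longrightarrow> \<exists>r\<in>R. dist r g < e"
proof -
  have comp: "compact (closure G)" using assms(1) by simp
  have cover: "closure G \<subseteq> (\<Union>g\<in>G. ball g e)"
  proof
    fix x assume "x \<in> closure G"
    then show "x \<in> (\<Union>g\<in>G. ball g e)" using assms(2) by (auto simp: closure_approachable)
  qed
  obtain R where R: "R \<subseteq> G" "finite R" "closure G \<subseteq> (\<Union>g\<in>R. ball g e)"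
    by (rule compactE_image[OF comp _ cover]) auto
  have "\<exists>r\<in>R. dist r g < e" if "g \<in> G" for g
    using subsetD[OF R(3) subsetD[OF closure_subset that]] by simp
  then show ?thesis using that[OF R(2,1)] by simp
qed

section \<open>Joining all values to finitely many\<close>

lemma finite_components_negative:
  fixes c :: complex
  assumes "Re c < 0"
  shows "finite (components (closure (divisor_sigma c ` {n. n > 0})))"
proof -
  define K where "K = closure (divisor_sigma c ` {n. n > 0})"
  obtain X h \<rho> :: real and F :: "nat \<Rightarrow> complex set" where X: "X \<ge> 1" and \<rho>: "\<rho> > 0"
    and conF: "\<And>i. connected (F i)" and oneF: "\<And>i. 1 \<in> F i"
    and F_sub: "\<And>i n. n > 0 \<Longrightarrow> (\<And>p. prime p \<Longrightarrow> p dvd n \<Longrightarrow> real p \<le> X * 64 ^ i) \<Longrightarrow>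
      (*) (divisor_sigma c n) ` F i \<subseteq> K"
    and meet: "\<And>i w. w \<noteq> 0 \<Longrightarrow> (Im c = 0 \<Longrightarrow> w \<in> \<real> \<and> Re w > 0) \<Longrightarrow> norm (w - 1) \<le> \<rho> * h ^ i \<Longrightarrow>
      (*) w ` F i \<inter> F i \<noteq> {}"
    and near: "\<And>i p k. prime p \<Longrightarrow> X * 64 ^ i < real p \<Longrightarrow> norm (divisor_sigma c (p ^ k) - 1) \<le> \<rho> * h ^ Suc i"
    unfolding K_def by (rule connected_rough_sets[OF assms]) blast
  define P where "P = primes_in 0 X"
  define smooth where "smooth n \<longleftrightarrow> n > 0 \<and> (\<forall>p. prime p \<longrightarrow> p dvd n \<longrightarrow> real p \<le> X)" for n :: nat
  have smoothP: "p \<in> P" if "smooth n" "prime p" "p dvd n" for n p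
    using that by (auto simp: smooth_def P_def primes_in_def prime_gt_0_nat)
  \<comment> \<open>The prime factors of \<open>n\<close> lie in the finite set
    \<open>{..n}\<close>, so the bounds for smooth integers apply to each single
    \<open>n\<close>.\<close>
  have nz: "divisor_sigma c n \<noteq> 0" if "n > 0" for n
  proof -
    obtain B where B: "B \<ge> 1" "\<And>m. m > 0 \<Longrightarrow> (\<And>p. prime p \<Longrightarrow> p dvd m \<Longrightarrow> p \<in> {..n}) \<Longrightarrow>
      norm (divisor_sigma c m) \<le> B \<and> 1 / B \<le> norm (divisor_sigma c m)"
      by (rule norm_divisor_sigma_smooth_bounds[OF assms, of "{..n}"]) auto
    have "1 / B \<le> norm (divisor_sigma c n)" using B(2)[OF that] that by (auto dest: dvd_imp_le)
    then show ?thesis using B(1) by auto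
  qed
  \<comment> \<open>The multiples of \<open>F i\<close> by the two values lie in \<open>K\<close>
    and contain these values, as \<open>1 \<in> F i\<close>. They meet because the quotient is close
    enough to 1.\<close>
  have join: "connected_component K (divisor_sigma c m) (divisor_sigma c n)"
    if mn: "m > 0" "n > 0" "\<And>p. prime p \<Longrightarrow> p dvd m \<Longrightarrow> real p \<le> X * 64 ^ i"
      "\<And>p. prime p \<Longrightarrow> p dvd n \<Longrightarrow> real p \<le> X * 64 ^ i"
      "norm (divisor_sigma c n / divisor_sigma c m - 1) \<le> \<rho> * h ^ i" for m n i
  proof -
    define w where "w = divisor_sigma c n / divisor_sigma c m"
    have w: "divisor_sigma c n = divisor_sigma c m * w" using nz mn(1) by (simp add: w_def)
    have "w \<noteq> 0" using nz mn(1,2) by (simp add: w_def)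
    moreover have "w \<in> \<real> \<and> Re w > 0" if real: "Im c = 0"
    proof -
      obtain x y where "divisor_sigma c n = of_real x" "divisor_sigma c m = of_real y"
        using divisor_sigma_real_pos(1)[OF real] \<open>m > 0\<close> \<open>n > 0\<close> by (metis Reals_cases)
      moreover have "Re (divisor_sigma c n) > 0" "Re (divisor_sigma c m) > 0"
        using divisor_sigma_real_pos(2)[OF real] \<open>m > 0\<close> \<open>n > 0\<close> by auto
      ultimately show ?thesis by (simp add: w_def flip: of_real_divide)
    qed
    ultimately obtain x y where xy: "x \<in> F i" "y \<in> F i" "w * x = y"
      using meet[of w i] mn(5) unfolding w_def[symmetric] by blast
    have con: "connected ((*) (divisor_sigma c k) ` F i)" for k
      using conF by (intro connected_continuous_image continuous_intros)
    have mem: "divisor_sigma c k \<in> (*) (divisor_sigma c k) ` F i" for k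
      by (rule image_eqI[OF _ oneF]) simp
    have "divisor_sigma c n * x = divisor_sigma c m * y" using w xy(3) by (simp add: mult.assoc)
    then have "(*) (divisor_sigma c m) ` F i \<inter> (*) (divisor_sigma c n) ` F i \<noteq> {}" using xy by force
    then have "connected ((*) (divisor_sigma c m) ` F i \<union> (*) (divisor_sigma c n) ` F i)"
      by (intro connected_Un con)
    moreover have "(*) (divisor_sigma c m) ` F i \<union> (*) (divisor_sigma c n) ` F i \<subseteq> K"
      using F_sub[OF mn(1,3)] F_sub[OF mn(2,4)] by simp
    ultimately show ?thesis using mem by (intro connected_component_if_subset) auto
  qed
  \<comment> \<open>Strong induction that removes the full power of the largest prime factor until
    none exceeds \<open>X\<close>.\<close>
  have to_smooth: "\<exists>s. smooth s \<and> connected_component K (divisor_sigma c s) (divisor_sigma c n)" if "n > 0" for n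
    using that
  proof (induction n rule: less_induct)
    case (less n)
    show ?case
    proof (cases "smooth n")
      case True
      have "divisor_sigma c n \<in> K" unfolding K_def using less.prems by (intro closure_subset[THEN subsetD] imageI) simp
      then show ?thesis using True by (intro exI[of _ n] conjI connected_component_refl)
    next
      case False
      then obtain p' where p': "prime p'" "p' dvd n" "real p' > X" using less.prems by (auto simp: smooth_def not_le)
      define p where "p = Max (prime_factors n)"
      have "p' \<in> prime_factors n" using p' less.prems by (simp add: in_prime_factors_iff)
      then have p: "p \<in> prime_factors n" "p' \<le> p" unfolding p_def by (auto intro: Max_in)
      have pmax: "r \<le> p" if "prime r" "r dvd n" for r
        unfolding p_def using that less.prems by (intro Max_ge) (auto simp: in_prime_factors_iff)
      have pp: "prime p" "p dvd n" "real p > X" using p p'(3) by (auto simp: in_prime_factors_iff)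
      obtain m k where m: "n = m * p ^ k" "coprime m (p ^ k)" "m > 0" "\<not> p dvd m"
        by (rule split_off_prime_power[OF less.prems pp(1)])
      have "k \<noteq> 0" using m pp(2) by (metis mult.right_neutral power_0)
      then have "p ^ k > 1" using prime_gt_1_nat[OF pp(1)] by (intro one_less_power) auto
      then have "m < n" using m by simp
      then obtain s where s: "smooth s" "connected_component K (divisor_sigma c s) (divisor_sigma c m)"
        using less.IH m(3) by blast
      \<comment> \<open>All prime factors of \<open>n\<close> and \<open>m\<close> are at most
        \<open>p\<close>, so level \<open>j\<close> is admissible for both, while minimality puts
        \<open>p\<close> beyond level \<open>j - 1\<close>, from where \<open>near\<close> supplies
        exactly the tolerance of level \<open>j\<close>.\<close>
      define j where "j = (LEAST j. real p \<le> X * 64 ^ j)"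
      have "\<exists>j. real p \<le> X * 64 ^ j"
      proof -
        obtain j where "real p < 64 ^ j" using real_arch_pow[of 64 "real p"] by auto
        also have "\<dots> \<le> X * 64 ^ j" using X by simp
        finally show ?thesis by (auto intro: less_imp_le)
      qed
      then have j: "real p \<le> X * 64 ^ j" unfolding j_def by (rule LeastI_ex)
      then have "j \<noteq> 0" using pp(3) by (intro notI) simp
      then obtain i where i: "j = Suc i" by (cases j) auto
      have "\<not> real p \<le> X * 64 ^ i" using not_less_Least[of i "\<lambda>j. real p \<le> X * 64 ^ j"] i unfolding j_def by simp
      then have lt: "X * 64 ^ i < real p" by simp
      have "divisor_sigma c n = divisor_sigma c m * divisor_sigma c (p ^ k)"
        unfolding m(1) using m pp(1) by (intro divisor_sigma_mult_coprime) (auto simp: prime_gt_0_nat)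
      then have "divisor_sigma c n / divisor_sigma c m = divisor_sigma c (p ^ k)" using nz[OF m(3)] by simp
      then have "norm (divisor_sigma c n / divisor_sigma c m - 1) \<le> \<rho> * h ^ j"
        using near[OF pp(1) lt] i by simp
      moreover have "real r \<le> X * 64 ^ j" if "prime r" "r dvd n" for r
        using pmax[OF that] j by linarith
      moreover have "real r \<le> X * 64 ^ j" if "prime r" "r dvd m" for r
        using pmax[of r] that m(1) j by simp
      ultimately have "connected_component K (divisor_sigma c m) (divisor_sigma c n)"
        using m(3) less.prems by (intro join[where i = j]) auto
      then have "connected_component K (divisor_sigma c s) (divisor_sigma c n)"
        by (rule connected_component_trans[OF s(2)])
      then show ?thesis using s(1) by (intro exI[of _ s] conjI)
    qed
  qed
  obtain B where B: "B \<ge> 1" "\<And>n. n > 0 \<Longrightarrow> (\<And>p. prime p \<Longrightarrow> p dvd n \<Longrightarrow> p \<in> P) \<Longrightarrow>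
      norm (divisor_sigma c n) \<le> B \<and> 1 / B \<le> norm (divisor_sigma c n)"
    using norm_divisor_sigma_smooth_bounds[OF assms, of P] unfolding P_def by auto
  have Bs: "norm (divisor_sigma c s) \<le> B" "1 / B \<le> norm (divisor_sigma c s)" if "smooth s" for s
    using B(2)[of s] smoothP[OF that] that by (auto simp: smooth_def)
  have "bounded (divisor_sigma c ` Collect smooth)"
    unfolding bounded_iff using Bs by blast
  \<comment> \<open>Smooth values have norm at least \<open>1 / B\<close>, so the spacing
    \<open>\<rho> / B\<close> puts quotients within \<rho> of 1, the tolerance at level 0.\<close>
  then obtain R where R: "finite R" "R \<subseteq> divisor_sigma c ` Collect smooth"
    "\<And>g. g \<in> divisor_sigma c ` Collect smooth \<Longrightarrow> \<exists>r\<in>R. dist r g < \<rho> / B"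
    by (rule bounded_finite_net[of _ "\<rho> / B"]) (use \<rho> B in auto)
  have "finite (components K)" unfolding K_def
  proof (rule finite_components_closure[OF R(1)])
    fix x assume "x \<in> divisor_sigma c ` {n. n > 0}"
    then obtain n where n: "n > 0" "x = divisor_sigma c n" by auto
    obtain s where s: "smooth s" "connected_component K (divisor_sigma c s) x" using to_smooth[OF n(1)] n(2) by blast
    obtain r where r: "r \<in> R" "dist r (divisor_sigma c s) < \<rho> / B" using R(3) s(1) by blast
    obtain t where t: "smooth t" "r = divisor_sigma c t" using R(2) r(1) by auto
    have t0: "norm r > 0" using nz t by (simp add: smooth_def)
    have "norm (divisor_sigma c s / r - 1) = dist r (divisor_sigma c s) / norm r"
      using t0 by (simp add: dist_norm norm_minus_commute diff_divide_distrib flip: norm_divide)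
    also have "\<dots> \<le> (\<rho> / B) / (1 / B)"
      using r(2) Bs(2)[OF t(1)] t(2) B(1) \<rho> by (intro frac_le) auto
    also have "\<dots> = \<rho> * h ^ 0" using B(1) by simp
    finally have "connected_component K r (divisor_sigma c s)"
      unfolding t(2) using s(1) t(1) by (intro join[where i = 0]) (auto simp: smooth_def)
    then have "connected_component K r x" using s(2) by (rule connected_component_trans)
    then show "\<exists>r\<in>R. connected_component (closure (divisor_sigma c ` {n. n > 0})) r x"
      using r(1) unfolding K_def by (rule bexI)
  qed
  then show ?thesis by (simp add: K_def)
qed

theorem theorem3:
  fixes c :: complex
  assumes "Re c \<le> 0" and "c \<noteq> 0"
  shows "finite (components (closure (divisor_sigma c ` {n. n > 0})))"
  using assms finite_components_negative[of c] finite_components_imaginary[of c] by linarith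

end
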